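(* Let $q\ge 0$ be an integer, let $G$ be a polycyclic group given by a consistent polycyclic presentation $G=F_n/R$, let $E_q(G)=F_n/R^q[F_n,R]$, and let $\pi:E_q(G)\to G$ be the natural epimorphism. Then $$Z_q^\wedge(G)=\big(Z(E_q(G))\big)\pi ,$$ i.e. the $q$-exterior center of $G$ is the image under $\pi$ of the center of $E_q(G)$.
   Context: Conventions: $y^x=x^{-1}yx$, $[x,y]=x^{-1}y^{-1}xy$; maps are written on the right. For a group $X$, $X^q$ is the subgroup generated by all $q$-th powers of elements of $X$ (trivial if $q=0$), and $Z(X)$ is the center. Here $F_n$ is the free group on the generators $g_1,\dots,g_n$ and $R$ is the normal closure of the relators. A polycyclic presentation on $g_1,\dots,g_n$ has relations of the form $g_i^{e_i}=g_{i+1}^{\alpha_{i,i+1}}\cdots g_n^{\alpha_{i,n}}$ for $i\in I$; $g_j^{-1}g_ig_j=g_{j+1}^{\beta_{i,j,j+1}}\cdots g_n^{\beta_{i,j,n}}$ for $j<i$; $g_jg_ig_j^{-1}=g_{j+1}^{\gamma_{i,j,j+1}}\cdots g_n^{\gamma_{i,j,n}}$ for $j<i$, $j\notin I$, where $I\subseteq\{1,\dots,n\}$, $e_i\in\mathbb N$ and the other exponents are integers. It is consistent if every element of the group is uniquely of the form $g_1^{a_1}\cdots g_n^{a_n}$ with $a_i\in\mathbb Z$ and $0\le a_i<e_i$ for $i\in I$. For $q\ge1$ the $q$-tensor square $G\otimes^qG$ is the group generated by symbols $g\otimes h$ and $\widehat k$ ($g,h,k\in G$) subject to, for all $g,g_1,h,h_1,k,k_1\in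 G$: (1) $g\otimes hh_1=(g\otimes h_1)(g^{h_1}\otimes h^{h_1})$; (2) $gg_1\otimes h=(g^{g_1}\otimes h^{g_1})(g_1\otimes h)$; (3) $(g\otimes h)^{\widehat k}=g^{k^q}\otimes h^{k^q}$; (4) $\widehat{kk_1}=\widehat k\,\prod_{i=1}^{q-1}(k\otimes k_1^{-i})^{k^{q-1-i}}\,\widehat{k_1}$, where $(g\otimes h)^x=g^x\otimes h^x$ for $x\in G$; (5) $[\widehat k,\widehat{k_1}]=k^q\otimes k_1^q$; (6) $\widehat{[g,h]}=(g\otimes h)^q$. For $q=0$ it is the group generated by the symbols $g\otimes h$ subject to (1) and (2) only. The $q$-exterior square is $G\wedge^qG=(G\otimes^qG)/\nabla^q(G)$, where $\nabla^q(G)=\langle g\otimes g\mid g\in G\rangle$ is a central subgroup; $g\wedge h$ denotes the image of $g\otimes h$. The $q$-exterior center of $G$ is $$Z_q^\wedge(G)=\{g\in G\mid g\wedge x=1\in G\wedge^qG\text{ for all }x\in G\}.$$ *)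

theory Defs
  imports "HOL-Algebra.Generated_Groups"
begin

section \<open>Free groups\<close>

text \<open>
  The free group on \<open>S\<close> consists of the reduced words in the letters \<open>(a, b)\<close>, \<open>a \<in> S\<close>,
  where \<open>(a, True)\<close> stands for \<open>a\<close> and \<open>(a, False)\<close> for its formal inverse.
  Words are multiplied by concatenation followed by free reduction.
\<close>

type_synonym 'a word = "('a \<times> bool) list"

definition letter_inv :: "'a \<times> bool \<Rightarrow> 'a \<times> bool" where
  "letter_inv x = (fst x, \<not> snd x)"

definition reduced :: "'a word \<Rightarrow> bool" where
  "reduced w \<longleftrightarrow> successively (\<lambda>x y. y \<noteq> letter_inv x) w"

fun cancel_cons :: "'a \<times> bool \<Rightarrow> 'a word \<Rightarrow> 'a word" where
  "cancel_cons x [] = [x]"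
| "cancel_cons x (y # w) = (if y = letter_inv x then w else x # y # w)"

definition free_group :: "'a set \<Rightarrow> 'a word monoid" where
  "free_group S = \<lparr>carrier = {w. fst ` set w \<subseteq> S \<and> reduced w},
                   mult = foldr cancel_cons, one = []\<rparr>"

definition free_gen :: "'a \<Rightarrow> 'a word" where
  "free_gen a = [(a, True)]"

lemma letter_inv_inv [simp]: "letter_inv (letter_inv x) = x"
  by (simp add: letter_inv_def)

lemma reduced_Nil [simp]: "reduced []"
  by (simp add: reduced_def)

lemma reduced_Cons: "reduced (x # w) \<longleftrightarrow> (w = [] \<or> hd w \<noteq> letter_inv x) \<and> reduced w"
  by (auto simp: reduced_def successively_Cons)

lemma reduced_cancel_cons: "reduced w \<Longrightarrow> reduced (cancel_cons x w)"
  by (cases w) (auto simp: reduced_Cons)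

lemma cancel_cons_cancel: "reduced w \<Longrightarrow> cancel_cons x (cancel_cons (letter_inv x) w) = w"
  by (cases w rule: list.exhaust; cases "tl w") (auto simp: reduced_Cons)

lemma cancel_cons_reduced: "reduced (x # w) \<Longrightarrow> cancel_cons x w = x # w"
  by (cases w) (auto simp: reduced_Cons)

lemma reduced_foldr: "reduced w \<Longrightarrow> reduced (foldr cancel_cons u w)"
  by (induction u) (auto simp: reduced_cancel_cons)

lemma foldr_cancel_cons_assoc:
  assumes "reduced w"
  shows "foldr cancel_cons (foldr cancel_cons u v) w = foldr cancel_cons u (foldr cancel_cons v w)"
proof (induction u)
  case (Cons x u)
  have "foldr cancel_cons (cancel_cons x t) w = cancel_cons x (foldr cancel_cons t w)" for t
    using cancel_cons_cancel[OF reduced_foldr[OF assms], of x]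
    by (cases t) auto
  with Cons show ?case by simp
qed simp

lemma foldr_cancel_cons_Nil: "reduced u \<Longrightarrow> foldr cancel_cons u [] = u"
  by (induction u) (auto simp: reduced_Cons cancel_cons_reduced)

lemma set_cancel_cons: "set (cancel_cons x w) \<subseteq> insert x (set w)"
  by (cases w) auto

lemma set_foldr_cancel_cons: "set (foldr cancel_cons u w) \<subseteq> set u \<union> set w"
proof (induction u)
  case (Cons x u)
  then show ?case using set_cancel_cons[of x "foldr cancel_cons u w"] by auto
qed simp

lemma free_group_left_inverse:
  "\<exists>v. fst ` set v \<subseteq> fst ` set u \<and> reduced v \<and> (\<forall>w. reduced w \<longrightarrow> foldr cancel_cons v (foldr cancel_cons u w) = w)"
proof (induction u)
  case (Cons x u)
  then obtain v where v: "fst ` set v \<subseteq> fst ` set u" "reduced v"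
    "\<And>w. reduced w \<Longrightarrow> foldr cancel_cons v (foldr cancel_cons u w) = w" by blast
  let ?v = "foldr cancel_cons v [letter_inv x]"
  have red: "reduced [letter_inv x]" by (simp add: reduced_Cons)
  have "foldr cancel_cons ?v (foldr cancel_cons (x # u) w) = w" if w: "reduced w" for w
    using foldr_cancel_cons_assoc[OF reduced_foldr[OF w, of "x # u"], of v "[letter_inv x]"]
      cancel_cons_cancel[OF reduced_foldr[OF w, of u], of "letter_inv x"] v(3)[OF w] by simp
  moreover have "fst ` set ?v \<subseteq> fst ` set (x # u)"
  proof -
    have "fst ` set ?v \<subseteq> fst ` (set v \<union> {letter_inv x})"
      using image_mono[OF set_foldr_cancel_cons[of v "[letter_inv x]"], of fst]
      by (simp only: list.set)
    also have "\<dots> = fst ` set v \<union> {fst x}"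
      by (simp add: letter_inv_def)
    finally show ?thesis using v(1) by auto
  qed
  ultimately show ?case using reduced_foldr[OF red, of v] by blast
qed auto

lemma group_free_group: "group (free_group S)"
proof (rule groupI)
  fix u v assume "u \<in> carrier (free_group S)" "v \<in> carrier (free_group S)"
  then show "u \<otimes>\<^bsub>free_group S\<^esub> v \<in> carrier (free_group S)"
    using set_foldr_cancel_cons[of u v] by (fastforce simp: free_group_def reduced_foldr)
next
  fix u assume u: "u \<in> carrier (free_group S)"
  obtain v where v: "fst ` set v \<subseteq> fst ` set u" "reduced v"
    "\<And>w. reduced w \<Longrightarrow> foldr cancel_cons v (foldr cancel_cons u w) = w"
    using free_group_left_inverse[of u] by blast
  show "\<exists>v\<in>carrier (free_group S). v \<otimes>\<^bsub>free_group S\<^esub> u = \<one>\<^bsub>free_group S\<^esub>"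
    using u v(1,2) v(3)[of "[]"]
    by (intro bexI[of _ v]) (auto simp: free_group_def foldr_cancel_cons_Nil)
qed (auto simp: free_group_def foldr_cancel_cons_assoc)

section \<open>Group-theoretic notions\<close>

definition conj_by :: "('a, 'm) monoid_scheme \<Rightarrow> 'a \<Rightarrow> 'a \<Rightarrow> 'a" where
  "conj_by G y x = inv\<^bsub>G\<^esub> x \<otimes>\<^bsub>G\<^esub> y \<otimes>\<^bsub>G\<^esub> x"

definition commutator :: "('a, 'm) monoid_scheme \<Rightarrow> 'a \<Rightarrow> 'a \<Rightarrow> 'a" where
  "commutator G x y = inv\<^bsub>G\<^esub> x \<otimes>\<^bsub>G\<^esub> inv\<^bsub>G\<^esub> y \<otimes>\<^bsub>G\<^esub> x \<otimes>\<^bsub>G\<^esub> y"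

definition commutator_subgroup :: "('a, 'm) monoid_scheme \<Rightarrow> 'a set \<Rightarrow> 'a set \<Rightarrow> 'a set" where
  "commutator_subgroup G H K = generate G {commutator G x y | x y. x \<in> H \<and> y \<in> K}"

definition power_subgroup :: "('a, 'm) monoid_scheme \<Rightarrow> nat \<Rightarrow> 'a set \<Rightarrow> 'a set" where
  "power_subgroup G q H = generate G {x [^]\<^bsub>G\<^esub> q | x. x \<in> H}"

definition group_center :: "('a, 'm) monoid_scheme \<Rightarrow> 'a set" where
  "group_center G = {z \<in> carrier G. \<forall>x\<in>carrier G. z \<otimes>\<^bsub>G\<^esub> x = x \<otimes>\<^bsub>G\<^esub> z}"

definition normal_closure :: "('a, 'm) monoid_scheme \<Rightarrow> 'a set \<Rightarrow> 'a set" where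
  "normal_closure G X = \<Inter> {N. N \<lhd> G \<and> X \<subseteq> N}"

definition list_mult :: "('a, 'm) monoid_scheme \<Rightarrow> 'a list \<Rightarrow> 'a" where
  "list_mult G xs = foldr (mult G) xs \<one>\<^bsub>G\<^esub>"

definition relator :: "('a, 'm) monoid_scheme \<Rightarrow> 'a \<Rightarrow> 'a \<Rightarrow> 'a" where
  "relator F l r = l \<otimes>\<^bsub>F\<^esub> inv\<^bsub>F\<^esub> r"

lemma (in group) normal_closure_normal:
  assumes "X \<subseteq> carrier G"
  shows "normal_closure G X \<lhd> G"
proof -
  have "carrier G \<in> {N. N \<lhd> G \<and> X \<subseteq> N}"
    using assms normal_self by blast
  then show ?thesis unfolding normal_closure_def
    by (auto simp: normal_inv_iff intro!: subgroups_Inter)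
qed

section \<open>Polycyclic presentations\<close>

text \<open>The product \<open>g\<^sub>j\<^sub>+\<^sub>1\<^bsup>a (j+1)\<^esup> \<cdots> g\<^sub>n\<^bsup>a n\<^esup>\<close>, computed in \<open>H\<close>.\<close>

definition pc_word :: "('b, 'm) monoid_scheme \<Rightarrow> (nat \<Rightarrow> 'b) \<Rightarrow> nat \<Rightarrow> nat \<Rightarrow> (nat \<Rightarrow> int) \<Rightarrow> 'b" where
  "pc_word H g j n a = list_mult H (map (\<lambda>k. g k [^]\<^bsub>H\<^esub> a k) [Suc j..<Suc n])"

definition pc_relators ::
  "nat \<Rightarrow> nat set \<Rightarrow> (nat \<Rightarrow> nat) \<Rightarrow> (nat \<Rightarrow> nat \<Rightarrow> int) \<Rightarrow> (nat \<Rightarrow> nat \<Rightarrow> nat \<Rightarrow> int) \<Rightarrow>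
   (nat \<Rightarrow> nat \<Rightarrow> nat \<Rightarrow> int) \<Rightarrow> nat word set" where
  "pc_relators n I e \<alpha> \<beta> \<gamma> =
    (let F = free_group {1..n} in
      {relator F (free_gen i [^]\<^bsub>F\<^esub> e i) (pc_word F free_gen i n (\<alpha> i)) | i. i \<in> I} \<union>
      {relator F (inv\<^bsub>F\<^esub> (free_gen j) \<otimes>\<^bsub>F\<^esub> free_gen i \<otimes>\<^bsub>F\<^esub> free_gen j)
                 (pc_word F free_gen j n (\<beta> i j)) | i j. 1 \<le> j \<and> j < i \<and> i \<le> n} \<union>
      {relator F (free_gen j \<otimes>\<^bsub>F\<^esub> free_gen i \<otimes>\<^bsub>F\<^esub> inv\<^bsub>F\<^esub> (free_gen j))
                 (pc_word F free_gen j n (\<gamma> i j)) | i j. 1 \<le> j \<and> j < i \<and> i \<le> n \<and> j \<notin> I})"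

definition pc_kernel ::
  "nat \<Rightarrow> nat set \<Rightarrow> (nat \<Rightarrow> nat) \<Rightarrow> (nat \<Rightarrow> nat \<Rightarrow> int) \<Rightarrow> (nat \<Rightarrow> nat \<Rightarrow> nat \<Rightarrow> int) \<Rightarrow>
   (nat \<Rightarrow> nat \<Rightarrow> nat \<Rightarrow> int) \<Rightarrow> nat word set" where
  "pc_kernel n I e \<alpha> \<beta> \<gamma> = normal_closure (free_group {1..n}) (pc_relators n I e \<alpha> \<beta> \<gamma>)"

definition pc_group ::
  "nat \<Rightarrow> nat set \<Rightarrow> (nat \<Rightarrow> nat) \<Rightarrow> (nat \<Rightarrow> nat \<Rightarrow> int) \<Rightarrow> (nat \<Rightarrow> nat \<Rightarrow> nat \<Rightarrow> int) \<Rightarrow>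
   (nat \<Rightarrow> nat \<Rightarrow> nat \<Rightarrow> int) \<Rightarrow> nat word set monoid" where
  "pc_group n I e \<alpha> \<beta> \<gamma> = free_group {1..n} Mod pc_kernel n I e \<alpha> \<beta> \<gamma>"

text \<open>
  The generators of the group are the cosets of the free generators. Exponent vectors are
  functions on \<open>{1..n}\<close>, taken extensional so that uniqueness is meaningful.
\<close>

definition pc_consistent ::
  "nat \<Rightarrow> nat set \<Rightarrow> (nat \<Rightarrow> nat) \<Rightarrow> (nat \<Rightarrow> nat \<Rightarrow> int) \<Rightarrow> (nat \<Rightarrow> nat \<Rightarrow> nat \<Rightarrow> int) \<Rightarrow>
   (nat \<Rightarrow> nat \<Rightarrow> nat \<Rightarrow> int) \<Rightarrow> bool" where
  "pc_consistent n I e \<alpha> \<beta> \<gamma> \<longleftrightarrow>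
    (let G = pc_group n I e \<alpha> \<beta> \<gamma>;
         g = (\<lambda>i. pc_kernel n I e \<alpha> \<beta> \<gamma> #>\<^bsub>free_group {1..n}\<^esub> free_gen i)
     in \<forall>x\<in>carrier G. \<exists>!a. a \<in> (\<Pi>\<^sub>E i\<in>{1..n}. if i \<in> I then {0..<int (e i)} else UNIV) \<and>
          x = pc_word G g 0 n a)"

section \<open>The extension \<open>E\<^sub>q(G) = F / R\<^sup>q[F, R]\<close>\<close>

definition q_cover_kernel :: "nat \<Rightarrow> ('a, 'm) monoid_scheme \<Rightarrow> 'a set \<Rightarrow> 'a set" where
  "q_cover_kernel q F R = power_subgroup F q R <#>\<^bsub>F\<^esub> commutator_subgroup F (carrier F) R"

definition q_cover :: "nat \<Rightarrow> ('a, 'm) monoid_scheme \<Rightarrow> 'a set \<Rightarrow> 'a set monoid" where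
  "q_cover q F R = F Mod q_cover_kernel q F R"

text \<open>
  The natural epimorphism sends the coset \<open>Sx\<close> of \<open>S = R\<^sup>q[F, R]\<close> to \<open>Rx\<close>. As \<open>S \<subseteq> R\<close>,
  the latter is the complex product of \<open>R\<close> and \<open>Sx\<close>; see \<open>q_cover_epi_coset\<close> below.
\<close>

definition q_cover_epi :: "('a, 'm) monoid_scheme \<Rightarrow> 'a set \<Rightarrow> 'a set \<Rightarrow> 'a set" where
  "q_cover_epi F R = (\<lambda>C. R <#>\<^bsub>F\<^esub> C)"

lemma (in group) q_cover_epi_coset:
  assumes R: "R \<lhd> G" and x: "x \<in> carrier G"
  shows "q_cover_epi G R (q_cover_kernel q G R #> x) = R #> x"
proof -
  interpret R: normal R G by (rule R)
  have "y [^] q \<in> R" if "y \<in> R" for y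
    using that by (induction q) auto
  then have "generate G {y [^] q | y. y \<in> R} \<subseteq> R"
    using R.subgroup_axioms by (intro generate_subgroup_incl) auto
  moreover have "commutator G y z \<in> R" if "y \<in> carrier G" "z \<in> R" for y z
    using that R.inv_op_closed1[of y "inv z"] by (auto simp: commutator_def)
  then have "commutator_subgroup G (carrier G) R \<subseteq> R"
    unfolding commutator_subgroup_def using R.subgroup_axioms by (intro generate_subgroup_incl) auto
  ultimately have sub: "q_cover_kernel q G R \<subseteq> R"
    by (auto simp: q_cover_kernel_def power_subgroup_def set_mult_def)
  have one: "\<one> \<in> q_cover_kernel q G R"
    unfolding q_cover_kernel_def power_subgroup_def commutator_subgroup_def set_mult_def
    using generate.one[of G] by force
  have "R <#> q_cover_kernel q G R = R"
  proof
    show "R <#> q_cover_kernel q G R \<subseteq> R" using sub by (auto simp: set_mult_def)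
    show "R \<subseteq> R <#> q_cover_kernel q G R"
    proof
      fix r assume "r \<in> R"
      then have "r = r \<otimes> \<one>" by simp
      with one \<open>r \<in> R\<close> show "r \<in> R <#> q_cover_kernel q G R" unfolding set_mult_def by blast
    qed
  qed
  moreover have "q_cover_kernel q G R \<subseteq> carrier G" using sub R.subset by blast
  ultimately show ?thesis
    using setmult_rcos_assoc[OF R.subset _ x, of "q_cover_kernel q G R"] by (simp add: q_cover_epi_def)
qed

section \<open>The \<open>q\<close>-tensor square, the \<open>q\<close>-exterior square and the \<open>q\<close>-exterior center\<close>

text \<open>
  \<open>Tens g h\<close> and \<open>Hat k\<close> are the symbols \<open>g \<otimes> h\<close> and \<open>k\<close> with a hat. For \<open>q = 0\<close> the hat symbols and
  all relations involving them are absent, so that one gets the ordinary non-abelian tensor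
  square. Actions are on the right, and \<open>tens_act\<close> is the diagonal conjugation action on symbols.
\<close>

datatype 'a tensor_sym = Tens 'a 'a | Hat 'a

definition tensor_syms :: "nat \<Rightarrow> ('a, 'm) monoid_scheme \<Rightarrow> 'a tensor_sym set" where
  "tensor_syms q G = {Tens g h | g h. g \<in> carrier G \<and> h \<in> carrier G} \<union>
     (if q = 0 then {} else {Hat k | k. k \<in> carrier G})"

definition tensor_free :: "nat \<Rightarrow> ('a, 'm) monoid_scheme \<Rightarrow> 'a tensor_sym word monoid" where
  "tensor_free q G = free_group (tensor_syms q G)"

abbreviation tens :: "'a \<Rightarrow> 'a \<Rightarrow> 'a tensor_sym word" where
  "tens g h \<equiv> free_gen (Tens g h)"

abbreviation hat :: "'a \<Rightarrow> 'a tensor_sym word" where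
  "hat k \<equiv> free_gen (Hat k)"

definition tens_act :: "('a, 'm) monoid_scheme \<Rightarrow> 'a \<Rightarrow> 'a \<Rightarrow> 'a \<Rightarrow> 'a tensor_sym word" where
  "tens_act G g h x = tens (conj_by G g x) (conj_by G h x)"

definition tensor_relators :: "nat \<Rightarrow> ('a, 'm) monoid_scheme \<Rightarrow> 'a tensor_sym word set" where
  "tensor_relators q G =
    (let T = tensor_free q G in
      {relator T (tens g (h \<otimes>\<^bsub>G\<^esub> h1)) (tens g h1 \<otimes>\<^bsub>T\<^esub> tens_act G g h h1) | g h h1.
         g \<in> carrier G \<and> h \<in> carrier G \<and> h1 \<in> carrier G} \<union>
      {relator T (tens (g \<otimes>\<^bsub>G\<^esub> g1) h) (tens_act G g h g1 \<otimes>\<^bsub>T\<^esub> tens g1 h) | g g1 h.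
         g \<in> carrier G \<and> g1 \<in> carrier G \<and> h \<in> carrier G})"

definition hat_relators :: "nat \<Rightarrow> ('a, 'm) monoid_scheme \<Rightarrow> 'a tensor_sym word set" where
  "hat_relators q G =
    (let T = tensor_free q G in
      {relator T (conj_by T (tens g h) (hat k)) (tens_act G g h (k [^]\<^bsub>G\<^esub> q)) | g h k.
         g \<in> carrier G \<and> h \<in> carrier G \<and> k \<in> carrier G} \<union>
      {relator T (hat (k \<otimes>\<^bsub>G\<^esub> k1))
         (hat k \<otimes>\<^bsub>T\<^esub>
          list_mult T (map (\<lambda>i. tens_act G k (inv\<^bsub>G\<^esub> k1 [^]\<^bsub>G\<^esub> i) (k [^]\<^bsub>G\<^esub> (q - 1 - i))) [1..<q]) \<otimes>\<^bsub>T\<^esub>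
          hat k1) | k k1. k \<in> carrier G \<and> k1 \<in> carrier G} \<union>
      {relator T (commutator T (hat k) (hat k1)) (tens (k [^]\<^bsub>G\<^esub> q) (k1 [^]\<^bsub>G\<^esub> q)) | k k1.
         k \<in> carrier G \<and> k1 \<in> carrier G} \<union>
      {relator T (hat (commutator G g h)) (tens g h [^]\<^bsub>T\<^esub> q) | g h.
         g \<in> carrier G \<and> h \<in> carrier G})"

definition tensor_kernel :: "nat \<Rightarrow> ('a, 'm) monoid_scheme \<Rightarrow> 'a tensor_sym word set" where
  "tensor_kernel q G = normal_closure (tensor_free q G)
     (tensor_relators q G \<union> (if q = 0 then {} else hat_relators q G))"

definition tensor_square :: "nat \<Rightarrow> ('a, 'm) monoid_scheme \<Rightarrow> 'a tensor_sym word set monoid" where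
  "tensor_square q G = tensor_free q G Mod tensor_kernel q G"

definition tensor :: "nat \<Rightarrow> ('a, 'm) monoid_scheme \<Rightarrow> 'a \<Rightarrow> 'a \<Rightarrow> 'a tensor_sym word set" where
  "tensor q G g h = tensor_kernel q G #>\<^bsub>tensor_free q G\<^esub> tens g h"

definition nabla :: "nat \<Rightarrow> ('a, 'm) monoid_scheme \<Rightarrow> 'a tensor_sym word set set" where
  "nabla q G = generate (tensor_square q G) {tensor q G g g | g. g \<in> carrier G}"

definition exterior_square ::
  "nat \<Rightarrow> ('a, 'm) monoid_scheme \<Rightarrow> 'a tensor_sym word set set monoid" where
  "exterior_square q G = tensor_square q G Mod nabla q G"

definition exterior :: "nat \<Rightarrow> ('a, 'm) monoid_scheme \<Rightarrow> 'a \<Rightarrow> 'a \<Rightarrow> 'a tensor_sym word set set" where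
  "exterior q G g h = nabla q G #>\<^bsub>tensor_square q G\<^esub> tensor q G g h"

definition exterior_center :: "nat \<Rightarrow> ('a, 'm) monoid_scheme \<Rightarrow> 'a set" where
  "exterior_center q G =
    {g \<in> carrier G. \<forall>x\<in>carrier G. exterior q G g x = \<one>\<^bsub>exterior_square q G\<^esub>}"

end

theory Submission
  imports Defs "HOL-Algebra.Elementary_Groups" "HOL-Algebra.FiniteProduct"
    "HOL-Algebra.SndIsomorphismGrp"
begin

text \<open>
  Let \<open>F\<close> be free on \<open>g\<^sub>1, \<dots>, g\<^sub>n\<close>, let \<open>R\<close> be normal in \<open>F\<close>, and put \<open>G = F / R\<close> and
  \<open>E = F / R\<^sup>q[F, R]\<close>. The kernel \<open>R / R\<^sup>q[F, R]\<close> of \<open>E \<rightarrow> G\<close> is central and of exponent dividing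
  \<open>q\<close>, so commutators and \<open>q\<close>-th powers in \<open>E\<close> depend only on the images of their arguments in
  \<open>G\<close>. As functions on \<open>G\<close> they satisfy the defining relations of the \<open>q\<close>-exterior square
  (\<open>q_exterior_pairing_commutator\<close>), whence a homomorphism \<open>G \<and>\<^sup>q G \<rightarrow> E\<close> sending \<open>g \<and> h\<close> to the
  commutator of lifts of \<open>g\<close> and \<open>h\<close>. Therefore every lift of an element of the exterior center is
  central in \<open>E\<close>.

  For the converse let \<open>x \<in> F\<close> be central modulo \<open>R\<^sup>q[F, R]\<close>; a relation \<open>[x, y] \<in> R\<^sup>q[F, R]\<close> in \<open>F\<close>
  has to be turned into a relation in \<open>G \<and>\<^sup>q G\<close>. Let \<open>W\<close> be the subgroup generated by all
  \<open>g \<and> h\<close>, on which \<open>G\<close> acts diagonally. A pair \<open>(a, t)\<close> of an exponent vector and an element of \<open>W\<close>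
  is read as the formal product \<open>g\<^sub>1\<^bsup>a 1\<^esup> \<cdots> g\<^sub>n\<^bsup>a n\<^esup> t\<close>, and the generator \<open>g\<^sub>j\<close> acts on such pairs as right
  multiplication would: it passes \<open>t\<close> and then \<open>v = g\<^sub>j\<^sub>+\<^sub>1\<^bsup>a (j+1)\<^esup> \<cdots> g\<^sub>n\<^bsup>a n\<^esup>\<close>, turning \<open>t\<close> into \<open>t\<close> conjugated by \<open>g\<^sub>j\<close>
  and leaving behind \<open>v \<and> g\<^sub>j\<close> in place of \<open>[v, g\<^sub>j]\<close>. As \<open>F\<close> is free, these permutations
  define an action of \<open>F\<close>. A computation with the identity \<open>[x, y] \<and> g = (x \<and> y)\<^sup>-\<^sup>1 (x \<and> y)\<^sup>g\<close> shows
  that \<open>[g\<^sub>i, g\<^sub>j]\<close> acts as right multiplication by \<open>g\<^sub>i \<and> g\<^sub>j\<close> (\<open>step_step\<close>), and the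
  product rules for \<open>\<and>\<close> propagate this to \<open>[x, y]\<close> for all \<open>x, y \<in> F\<close> (\<open>realize_mult_comm\<close>). In particular
  \<open>[F, R]\<close> acts trivially, and the elements of \<open>R\<close> act by permutations that commute with the
  action of \<open>F\<close>, so that an element of \<open>R\<^sup>q\<close> acts as \<open>r\<^sup>q\<close> for a single \<open>r \<in> R\<close>.

  It remains to see that \<open>r\<^sup>q\<close> acts trivially if \<open>[x, y] \<in> r\<^sup>q [F, F]\<close>, where \<open>q > 0\<close> may be assumed.
  The exponent sums of \<open>r\<close> vanish, so \<open>r \<in> [F, F]\<close>. By the relations for the hats of products and of commutators,
  \<open>z\<^sup>q\<close> acts as right multiplication by the hat of the image of \<open>z\<close> whenever \<open>z \<in> [F, F]\<close> (\<open>realize_power_derived\<close>), and the hat of the image of \<open>r\<close>, the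
  neutral element, is trivial. So \<open>[x, y]\<close> acts trivially; but it acts as multiplication by the
  wedge product of the images of \<open>x\<close> and \<open>y\<close>, which is therefore trivial.
\<close>

section \<open>Preliminaries on groups\<close>

lemma (in group) inv_mult_cancel [simp]:
  assumes "x \<in> carrier G" "y \<in> carrier G"
  shows "inv x \<otimes> (x \<otimes> y) = y" and "x \<otimes> (inv x \<otimes> y) = y"
  using assms by (simp_all flip: m_assoc)

lemma (in group) conj_by_closed [simp, intro]:
  assumes "x \<in> carrier G" "y \<in> carrier G"
  shows "conj_by G x y \<in> carrier G"
  using assms by (simp add: conj_by_def)

lemma (in group) commutator_closed [simp, intro]:
  assumes "x \<in> carrier G" "y \<in> carrier G"
  shows "commutator G x y \<in> carrier G"
  using assms by (simp add: commutator_def)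

lemma (in group) list_mult_closed [simp]:
  assumes "set xs \<subseteq> carrier G"
  shows "list_mult G xs \<in> carrier G"
  using assms by (induction xs) (simp_all add: list_mult_def)

lemma list_mult_Cons [simp]: "list_mult G (x # xs) = x \<otimes>\<^bsub>G\<^esub> list_mult G xs"
  by (simp add: list_mult_def)

lemma list_mult_Nil [simp]: "list_mult G [] = \<one>\<^bsub>G\<^esub>"
  by (simp add: list_mult_def)

lemma (in group) list_mult_append:
  assumes "set xs \<subseteq> carrier G" "set ys \<subseteq> carrier G"
  shows "list_mult G (xs @ ys) = list_mult G xs \<otimes> list_mult G ys"
  using assms by (induction xs) (simp_all add: m_assoc)

lemma (in group_hom) hom_conj_by:
  assumes "x \<in> carrier G" "y \<in> carrier G"
  shows "h (conj_by G x y) = conj_by H (h x) (h y)"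
  using assms by (simp add: conj_by_def)

lemma (in group_hom) hom_commutator:
  assumes "x \<in> carrier G" "y \<in> carrier G"
  shows "h (commutator G x y) = commutator H (h x) (h y)"
  using assms by (simp add: commutator_def)

lemma (in group_hom) hom_list_mult:
  assumes "set xs \<subseteq> carrier G"
  shows "h (list_mult G xs) = list_mult H (map h xs)"
  using assms by (induction xs) simp_all

lemma (in group_hom) relator_in_kernel_iff:
  assumes "l \<in> carrier G" "r \<in> carrier G"
  shows "relator G l r \<in> kernel G H h \<longleftrightarrow> h l = h r"
proof -
  have "h l \<otimes>\<^bsub>H\<^esub> inv\<^bsub>H\<^esub> h r = \<one>\<^bsub>H\<^esub> \<longleftrightarrow> h l = h r"
    using assms H.inv_solve_right'[of "\<one>\<^bsub>H\<^esub>" "h l" "h r"] by auto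
  then show ?thesis using assms by (simp add: relator_def kernel_def)
qed

lemma (in group_hom) normal_closure_subset_kernel:
  assumes "X \<subseteq> kernel G H h"
  shows "normal_closure G X \<subseteq> kernel G H h"
  using assms normal_kernel by (auto simp: normal_closure_def)

text \<open>The next two facts let coset maps and homomorphisms obtained otherwise be treated alike: an
  element lies in a normal subgroup iff it lies in the kernel of a homomorphism.\<close>

lemma (in normal) coset_hom: "group_hom G (G Mod H) ((#>) H)"
  using r_coset_hom_Mod factorgroup_is_group is_group
  by (intro group_hom.intro group_hom_axioms.intro) auto

lemma (in normal) coset_kernel: "kernel G (G Mod H) ((#>) H) = H"
  using coset_join1[OF _ _ subgroup_axioms] coset_join2[OF _ subgroup_axioms] subset
  by (auto simp: kernel_def)

text \<open>The expansion that the relation for the hat of a product imitates. If \<open>P q\<close> denotes the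
  middle factor, then \<open>x\<^sup>q (P q) = (x y)\<^sup>q y\<^sup>-\<^sup>q\<close>, by induction from \<open>P (q + 1) = (P q)\<^sup>x [x, y\<^sup>-\<^sup>q]\<close>.\<close>

lemma (in group) power_mult_expand:
  assumes x: "x \<in> carrier G" and y: "y \<in> carrier G"
  shows "(x \<otimes> y) [^] (q::nat) = x [^] q \<otimes>
    list_mult G (map (\<lambda>i. conj_by G (commutator G x (inv y [^] i)) (x [^] (q - 1 - i))) [1..<q]) \<otimes> y [^] q"
proof -
  define P where "P q = list_mult G
    (map (\<lambda>i. conj_by G (commutator G x (inv y [^] i)) (x [^] (q - 1 - i))) [1..<q])" for q :: nat
  have P_closed [simp]: "P q \<in> carrier G" for q
    unfolding P_def using x y by (intro list_mult_closed) auto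
  have P_Suc: "P (Suc q) = conj_by G (P q) x \<otimes> commutator G x (inv y [^] q)" if "q \<ge> 1" for q
  proof -
    interpret c: group_hom G G "\<lambda>z. conj_by G z x"
      using x by unfold_locales (auto simp: hom_def conj_by_def m_assoc)
    have "map (\<lambda>i. conj_by G (commutator G x (inv y [^] i)) (x [^] (Suc q - 1 - i))) [1..<q] =
      map (\<lambda>z. conj_by G z x)
        (map (\<lambda>i. conj_by G (commutator G x (inv y [^] i)) (x [^] (q - 1 - i))) [1..<q])"
      (is "map ?f _ = _")
    proof -
      have "?f i = conj_by G (conj_by G (commutator G x (inv y [^] i)) (x [^] (q - 1 - i))) x"
        if "i \<in> set [1..<q]" for i
      proof -
        from that have "Suc q - 1 - i = Suc (q - 1 - i)" by auto
        then show ?thesis using x y by (simp add: conj_by_def m_assoc inv_mult_group)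
      qed
      then show ?thesis by simp
    qed
    from arg_cong[OF this, of "list_mult G"]
    have "list_mult G (map ?f [1..<q]) = conj_by G (P q) x"
      unfolding P_def using x y by (subst c.hom_list_mult) auto
    moreover have "P (Suc q) = list_mult G (map ?f [1..<q]) \<otimes> list_mult G [?f q]"
      unfolding P_def using that x y by (subst list_mult_append[symmetric]) auto
    ultimately show ?thesis using x y by (simp add: conj_by_def)
  qed
  have "(x \<otimes> y) [^] q = x [^] q \<otimes> P q \<otimes> y [^] q"
  proof (cases q)
    case (Suc m)
    have "(x \<otimes> y) [^] (Suc m) = x [^] (Suc m) \<otimes> P (Suc m) \<otimes> y [^] (Suc m)"
    proof (induction m)
      case 0
      then show ?case using x y by (simp add: P_def)
    next
      case (Suc m)
      let ?q = "Suc m"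
      have yi: "inv y [^] ?q = inv (y [^] ?q)" using y by (rule nat_pow_inv)
      have P: "P (Suc ?q) = conj_by G (P ?q) x \<otimes> commutator G x (inv y [^] ?q)"
        by (rule P_Suc) simp
      have xs: "x [^] Suc ?q = x [^] ?q \<otimes> x" by simp
      have ys: "y [^] Suc ?q = y [^] ?q \<otimes> y" by simp
      have cl: "x [^] ?q \<in> carrier G" "y [^] ?q \<in> carrier G" using x y by auto
      have "(x \<otimes> y) [^] Suc ?q = x [^] ?q \<otimes> P ?q \<otimes> y [^] ?q \<otimes> (x \<otimes> y)"
        using Suc.IH by simp
      also have "\<dots> = x [^] Suc ?q \<otimes> P (Suc ?q) \<otimes> y [^] Suc ?q"
        unfolding P xs ys yi
        using x y cl by (simp add: conj_by_def commutator_def m_assoc inv_mult_group del: nat_pow_Suc)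
      finally show ?case .
    qed
    then show ?thesis using Suc by simp
  qed (simp add: P_def)
  then show ?thesis by (simp add: P_def)
qed

section \<open>Homomorphisms from free groups\<close>

definition word_value :: "('b, 'm) monoid_scheme \<Rightarrow> ('a \<Rightarrow> 'b) \<Rightarrow> 'a word \<Rightarrow> 'b" where
  "word_value H f w = foldr (\<lambda>(a, b) y. (if b then f a else inv\<^bsub>H\<^esub> f a) \<otimes>\<^bsub>H\<^esub> y) w \<one>\<^bsub>H\<^esub>"

lemma (in group) word_value_closed:
  assumes "\<And>a. a \<in> S \<Longrightarrow> f a \<in> carrier G" "fst ` set w \<subseteq> S"
  shows "word_value G f w \<in> carrier G"
  using assms(2) by (induction w) (auto simp: word_value_def assms(1))

lemma (in group) word_value_cancel_cons:
  assumes "\<And>a. a \<in> S \<Longrightarrow> f a \<in> carrier G" "fst ` set (x # w) \<subseteq> S"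
  shows "word_value G f (cancel_cons x w) = word_value G f (x # w)"
proof (cases w)
  case (Cons y v)
  have "word_value G f v \<in> carrier G"
    using assms Cons by (intro word_value_closed[of S]) auto
  then show ?thesis
    using assms Cons by (auto simp: word_value_def letter_inv_def split: prod.splits)
qed simp

lemma (in group) word_value_hom:
  assumes f: "\<And>a. a \<in> S \<Longrightarrow> f a \<in> carrier G"
  shows "group_hom (free_group S) G (word_value G f)"
proof -
  have "word_value G f (foldr cancel_cons u w) = word_value G f u \<otimes> word_value G f w"
    if "fst ` set u \<subseteq> S" "fst ` set w \<subseteq> S" for u w
    using that
  proof (induction u)
    case Nil
    then show ?case using word_value_closed[of S f w] f by (simp add: word_value_def)
  next
    case (Cons x u)
    obtain a b where x: "x = (a, b)" by (cases x)
    let ?v = "foldr cancel_cons u w"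
    have v: "fst ` set ?v \<subseteq> S" using set_foldr_cancel_cons[of u w] Cons.prems by fastforce
    have "word_value G f u \<in> carrier G" "word_value G f w \<in> carrier G"
      using Cons.prems f by (auto intro!: word_value_closed[of S])
    moreover have "word_value G f (cancel_cons x ?v) = word_value G f (x # ?v)"
      using Cons.prems v f by (intro word_value_cancel_cons[of S]) auto
    ultimately show ?case using Cons f[of a]
      by (auto simp: word_value_def x m_assoc)
  qed
  then have "word_value G f \<in> hom (free_group S) G"
    using f by (intro homI) (auto simp: free_group_def intro!: word_value_closed[of S])
  then show ?thesis
    using group_free_group is_group by (intro group_hom.intro group_hom_axioms.intro)
qed

lemma (in group) word_value_gen [simp]:
  "f a \<in> carrier G \<Longrightarrow> word_value G f (free_gen a) = f a"
  by (simp add: word_value_def free_gen_def)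

lemma free_gen_carrier [simp, intro]: "a \<in> S \<Longrightarrow> free_gen a \<in> carrier (free_group S)"
  by (simp add: free_group_def free_gen_def reduced_Cons)

text \<open>Free generators generate. Stated as an induction principle, since all later uses show that a
  property defines a subgroup.\<close>

lemma free_group_subgroup_induct:
  assumes K: "subgroup K (free_group S)" and gen: "\<And>a. a \<in> S \<Longrightarrow> free_gen a \<in> K"
    and w: "w \<in> carrier (free_group S)"
  shows "w \<in> K"
  using w
proof (induction w)
  case Nil
  then show ?case using subgroup.one_closed[OF K] by (simp add: free_group_def)
next
  case (Cons x w)
  interpret F: group "free_group S" by (rule group_free_group)
  obtain a b where x: "x = (a, b)" by (cases x)
  have a: "a \<in> S" and w: "w \<in> carrier (free_group S)" and red: "reduced (x # w)"
    using Cons.prems by (auto simp: free_group_def x reduced_Cons)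
  have "[(a, False)] = inv\<^bsub>free_group S\<^esub> (free_gen a)"
    using a by (intro F.inv_equality[symmetric])
      (auto simp: free_group_def free_gen_def letter_inv_def reduced_Cons)
  then have "[x] \<in> K"
    using gen[OF a] subgroup.m_inv_closed[OF K gen[OF a]] by (cases b) (auto simp: x free_gen_def)
  moreover have "x # w = [x] \<otimes>\<^bsub>free_group S\<^esub> w"
    using cancel_cons_reduced[OF red] by (simp add: free_group_def)
  ultimately show ?case using subgroup.m_closed[OF K _ Cons.IH[OF w]] by simp
qed

lemma free_group_hom_eqI:
  assumes "group_hom (free_group S) H f" "group_hom (free_group S) H g"
    and gen: "\<And>a. a \<in> S \<Longrightarrow> f (free_gen a) = g (free_gen a)"
    and w: "w \<in> carrier (free_group S)"
  shows "f w = g w"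
proof -
  interpret f: group_hom "free_group S" H f by (rule assms(1))
  interpret g: group_hom "free_group S" H g by (rule assms(2))
  have "subgroup {w \<in> carrier (free_group S). f w = g w} (free_group S)"
    by (rule group.subgroupI[OF group_free_group]) auto
  from free_group_subgroup_induct[OF this _ w] gen show ?thesis by simp
qed

section \<open>Tensor and exterior pairings\<close>

lemma (in group) conj_by_mult:
  assumes "x \<in> carrier G" "y \<in> carrier G" "z \<in> carrier G"
  shows "conj_by G (x \<otimes> y) z = conj_by G x z \<otimes> conj_by G y z"
  using assms by (simp add: conj_by_def m_assoc)

lemma (in group) conj_by_conj_by:
  assumes "x \<in> carrier G" "y \<in> carrier G" "z \<in> carrier G"
  shows "conj_by G (conj_by G x y) z = conj_by G x (y \<otimes> z)"
  using assms by (simp add: conj_by_def m_assoc inv_mult_group)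

lemma (in group) mult_conj_by:
  assumes "x \<in> carrier G" "y \<in> carrier G"
  shows "x \<otimes> conj_by G y x = y \<otimes> x"
  using assms by (simp add: conj_by_def m_assoc)

lemma (in group) conj_by_one [simp]:
  "x \<in> carrier G \<Longrightarrow> conj_by G x \<one> = x" "x \<in> carrier G \<Longrightarrow> conj_by G \<one> x = \<one>"
  by (simp_all add: conj_by_def)

lemma (in group) conj_by_hom:
  "x \<in> carrier G \<Longrightarrow> group_hom G G (\<lambda>g. conj_by G g x)"
  using is_group by (intro group_hom.intro group_hom_axioms.intro homI) (auto simp: conj_by_mult)

text \<open>The defining relations of the tensor square, as conditions on arbitrary functions into a group:
  a homomorphism out of the tensor square is the same as a pair of functions satisfying them.\<close>

definition tensor_relations ::
  "('a, 'm) monoid_scheme \<Rightarrow> ('b, 'k) monoid_scheme \<Rightarrow> ('a \<Rightarrow> 'a \<Rightarrow> 'b) \<Rightarrow> bool" where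
  "tensor_relations G T w \<longleftrightarrow>
    (\<forall>g\<in>carrier G. \<forall>h\<in>carrier G. \<forall>h1\<in>carrier G.
      w g (h \<otimes>\<^bsub>G\<^esub> h1) = w g h1 \<otimes>\<^bsub>T\<^esub> w (conj_by G g h1) (conj_by G h h1)) \<and>
    (\<forall>g\<in>carrier G. \<forall>g1\<in>carrier G. \<forall>h\<in>carrier G.
      w (g \<otimes>\<^bsub>G\<^esub> g1) h = w (conj_by G g g1) (conj_by G h g1) \<otimes>\<^bsub>T\<^esub> w g1 h)"

text \<open>The factor between the two hats in the relation for the hat of a product.\<close>

definition hat_expansion ::
  "nat \<Rightarrow> ('a, 'm) monoid_scheme \<Rightarrow> ('b, 'k) monoid_scheme \<Rightarrow> ('a \<Rightarrow> 'a \<Rightarrow> 'b) \<Rightarrow> 'a \<Rightarrow> 'a \<Rightarrow> 'b" where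
  "hat_expansion q G T w k k1 = list_mult T (map (\<lambda>i. w (conj_by G k (k [^]\<^bsub>G\<^esub> (q - 1 - i)))
     (conj_by G (inv\<^bsub>G\<^esub> k1 [^]\<^bsub>G\<^esub> i) (k [^]\<^bsub>G\<^esub> (q - 1 - i)))) [1..<q])"

definition hat_relations ::
  "nat \<Rightarrow> ('a, 'm) monoid_scheme \<Rightarrow> ('b, 'k) monoid_scheme \<Rightarrow> ('a \<Rightarrow> 'a \<Rightarrow> 'b) \<Rightarrow> ('a \<Rightarrow> 'b) \<Rightarrow> bool" where
  "hat_relations q G T w h \<longleftrightarrow>
    (\<forall>g\<in>carrier G. \<forall>g1\<in>carrier G. \<forall>k\<in>carrier G.
      conj_by T (w g g1) (h k) = w (conj_by G g (k [^]\<^bsub>G\<^esub> q)) (conj_by G g1 (k [^]\<^bsub>G\<^esub> q))) \<and>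
    (\<forall>k\<in>carrier G. \<forall>k1\<in>carrier G.
      h (k \<otimes>\<^bsub>G\<^esub> k1) = h k \<otimes>\<^bsub>T\<^esub> hat_expansion q G T w k k1 \<otimes>\<^bsub>T\<^esub> h k1) \<and>
    (\<forall>k\<in>carrier G. \<forall>k1\<in>carrier G.
      commutator T (h k) (h k1) = w (k [^]\<^bsub>G\<^esub> q) (k1 [^]\<^bsub>G\<^esub> q)) \<and>
    (\<forall>g\<in>carrier G. \<forall>g1\<in>carrier G. h (commutator G g g1) = w g g1 [^]\<^bsub>T\<^esub> q)"

locale tensor_pairing = group G + T: group T
  for G (structure) and T (structure) +
  fixes w :: "'a \<Rightarrow> 'a \<Rightarrow> 'c"
  assumes w_closed [simp, intro]: "\<lbrakk>g \<in> carrier G; h \<in> carrier G\<rbrakk> \<Longrightarrow> w g h \<in> carrier T"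
    and w_relations: "tensor_relations G T w"

locale exterior_pairing = tensor_pairing +
  assumes w_self [simp]: "g \<in> carrier G \<Longrightarrow> w g g = \<one>\<^bsub>T\<^esub>"

locale q_exterior_pairing = exterior_pairing +
  fixes q :: nat and hatv :: "'a \<Rightarrow> 'c"
  assumes hat_closed: "\<lbrakk>0 < q; k \<in> carrier G\<rbrakk> \<Longrightarrow> hatv k \<in> carrier T"
    and hat_relations: "0 < q \<Longrightarrow> hat_relations q G T w hatv"

context tensor_pairing
begin

lemma w_mult_right:
  assumes "g \<in> carrier G" "h \<in> carrier G" "h1 \<in> carrier G"
  shows "w g (h \<otimes> h1) = w g h1 \<otimes>\<^bsub>T\<^esub> w (conj_by G g h1) (conj_by G h h1)"
  using w_relations assms by (auto simp: tensor_relations_def)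

lemma w_mult_left:
  assumes "g \<in> carrier G" "g1 \<in> carrier G" "h \<in> carrier G"
  shows "w (g \<otimes> g1) h = w (conj_by G g g1) (conj_by G h g1) \<otimes>\<^bsub>T\<^esub> w g1 h"
  using w_relations assms by (auto simp: tensor_relations_def)

lemma w_one [simp]:
  assumes "g \<in> carrier G"
  shows "w g \<one> = \<one>\<^bsub>T\<^esub>" and "w \<one> g = \<one>\<^bsub>T\<^esub>"
  using w_mult_right[of g \<one> \<one>] w_mult_left[of \<one> \<one> g] assms T.r_cancel_one' T.l_cancel_one'
  by auto

text \<open>Expanding \<open>w (g g\<^sub>1) (h h\<^sub>1)\<close> in the two possible orders and cancelling shows that
  \<open>w g\<^sub>1 h\<^sub>1\<close> conjugates values of \<open>w\<close> in the same way as \<open>[g\<^sub>1, h\<^sub>1]\<close> does. The inverse-free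
  form is the one that later computations use.\<close>

lemma crossed_identity:
  assumes "g \<in> carrier G" "h \<in> carrier G" "g1 \<in> carrier G" "h1 \<in> carrier G"
  shows "w g1 h1 \<otimes>\<^bsub>T\<^esub> w (conj_by G g (g1 \<otimes> h1)) (conj_by G h (g1 \<otimes> h1)) =
         w (conj_by G g (h1 \<otimes> g1)) (conj_by G h (h1 \<otimes> g1)) \<otimes>\<^bsub>T\<^esub> w g1 h1"
proof -
  let ?a = "w (conj_by G g g1) (conj_by G h1 g1)" and ?z = "w (conj_by G g1 h1) (conj_by G h h1)"
  have "w (g \<otimes> g1) (h \<otimes> h1) = ?a \<otimes>\<^bsub>T\<^esub> (w g1 h1 \<otimes>\<^bsub>T\<^esub>
      w (conj_by G g (h1 \<otimes> conj_by G g1 h1)) (conj_by G h (h1 \<otimes> conj_by G g1 h1))) \<otimes>\<^bsub>T\<^esub> ?z"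
    using assms by (subst w_mult_right)
      (simp_all add: w_mult_left conj_by_mult conj_by_conj_by T.m_assoc)
  moreover have "w (g \<otimes> g1) (h \<otimes> h1) = ?a \<otimes>\<^bsub>T\<^esub>
      (w (conj_by G g (g1 \<otimes> conj_by G h1 g1)) (conj_by G h (g1 \<otimes> conj_by G h1 g1)) \<otimes>\<^bsub>T\<^esub>
      w g1 h1) \<otimes>\<^bsub>T\<^esub> ?z"
    using assms by (subst w_mult_left)
      (simp_all add: w_mult_right conj_by_mult conj_by_conj_by T.m_assoc)
  ultimately show ?thesis using assms by (simp add: mult_conj_by)
qed

lemma conj_by_w:
  assumes "g \<in> carrier G" "h \<in> carrier G" "g1 \<in> carrier G" "h1 \<in> carrier G"
  shows "conj_by T (w g h) (w g1 h1) =
         w (conj_by G g (commutator G g1 h1)) (conj_by G h (commutator G g1 h1))"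
proof -
  let ?u = "conj_by G g (inv (h1 \<otimes> g1))" and ?v = "conj_by G h (inv (h1 \<otimes> g1))"
  have "commutator G g1 h1 = inv (h1 \<otimes> g1) \<otimes> (g1 \<otimes> h1)"
    using assms by (simp add: commutator_def m_assoc inv_mult_group)
  then have "w g h \<otimes>\<^bsub>T\<^esub> w g1 h1 = w g1 h1 \<otimes>\<^bsub>T\<^esub>
      w (conj_by G g (commutator G g1 h1)) (conj_by G h (commutator G g1 h1))"
    using crossed_identity[of ?u ?v g1 h1] assms by (simp add: conj_by_conj_by)
  with assms show ?thesis by (simp add: conj_by_def T.m_assoc)
qed

end

lemma (in group_hom) tensor_pairing_pullback:
  assumes "tensor_pairing H T w"
  shows "tensor_pairing G T (\<lambda>x y. w (h x) (h y))"
proof -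
  interpret w: tensor_pairing H T w by (rule assms)
  show ?thesis
    by unfold_locales (auto simp: tensor_relations_def hom_conj_by w.w_mult_left w.w_mult_right)
qed

lemma (in group_hom) q_exterior_pairing_pullback:
  assumes "q_exterior_pairing H T w q k"
  shows "q_exterior_pairing G T (\<lambda>x y. w (h x) (h y)) q (\<lambda>x. k (h x))"
proof -
  interpret w: q_exterior_pairing H T w q k by (rule assms)
  interpret p: tensor_pairing G T "\<lambda>x y. w (h x) (h y)"
    by (rule tensor_pairing_pullback) (rule w.tensor_pairing_axioms)
  have "hat_expansion q G T (\<lambda>x y. w (h x) (h y)) x y = hat_expansion q H T w (h x) (h y)"
    if "x \<in> carrier G" "y \<in> carrier G" for x y
    using that by (simp add: hat_expansion_def hom_conj_by hom_nat_pow)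
  then show ?thesis using w.hat_relations
    by unfold_locales (auto simp: w.hat_closed hat_relations_def hom_conj_by hom_commutator hom_nat_pow)
qed

section \<open>Presentation of the exterior square\<close>

text \<open>Read from right to left this yields homomorphisms out of the quotient by the relators; read
  from left to right, for a quotient map, it yields the relations between the classes of symbols.\<close>

lemma group_hom_relators_subset_kernel_iff:
  fixes G (structure)
  assumes "group G" and "group_hom (tensor_free q G) H f"
  shows tensor_relators_subset_kernel_iff: "tensor_relators q G \<subseteq> kernel (tensor_free q G) H f \<longleftrightarrow>
      tensor_relations G H (\<lambda>g h. f (tens g h))" (is ?th1)
    and hat_relators_subset_kernel_iff: "0 < q \<Longrightarrow> hat_relators q G \<subseteq> kernel (tensor_free q G) H f \<longleftrightarrow>
      hat_relations q G H (\<lambda>g h. f (tens g h)) (\<lambda>k. f (hat k))"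
proof -
  interpret group G by (rule assms)
  interpret f: group_hom "tensor_free q G" H f by (rule assms)
  have tens [simp]: "tens g h \<in> carrier (tensor_free q G)" if "g \<in> carrier G" "h \<in> carrier G" for g h
    using that by (simp add: tensor_free_def tensor_syms_def)
  have collect2: "{F a b | a b. a \<in> A \<and> b \<in> A} \<subseteq> K \<longleftrightarrow> (\<forall>a\<in>A. \<forall>b\<in>A. F a b \<in> K)"
    for F :: "'a \<Rightarrow> 'a \<Rightarrow> 'a tensor_sym word" and A K by blast
  have collect3: "{F a b c | a b c. a \<in> A \<and> b \<in> A \<and> c \<in> A} \<subseteq> K \<longleftrightarrow>
      (\<forall>a\<in>A. \<forall>b\<in>A. \<forall>c\<in>A. F a b c \<in> K)"
    for F :: "'a \<Rightarrow> 'a \<Rightarrow> 'a \<Rightarrow> 'a tensor_sym word" and A K by blast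
  show ?th1
    unfolding tensor_relators_def Let_def Un_subset_iff collect3 tensor_relations_def
    by (intro arg_cong2[where f = "(\<and>)"] ball_cong refl)
      (simp_all add: f.relator_in_kernel_iff tens_act_def)
  assume "0 < q"
  then have hat [simp]: "hat g \<in> carrier (tensor_free q G)" if "g \<in> carrier G" for g
    using that by (simp add: tensor_free_def tensor_syms_def)
  have act [simp]: "tens_act G g h x \<in> carrier (tensor_free q G)"
    if "g \<in> carrier G" "h \<in> carrier G" "x \<in> carrier G" for g h x
    using that by (simp add: tens_act_def)
  let ?l = "\<lambda>k k1. list_mult (tensor_free q G)
    (map (\<lambda>i. tens_act G k (inv k1 [^] i) (k [^] (q - 1 - i))) [1..<q])"
  have l [simp]: "?l k k1 \<in> carrier (tensor_free q G)"
    and f_l: "f (?l k k1) = hat_expansion q G H (\<lambda>g h. f (tens g h)) k k1"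
    if "k \<in> carrier G" "k1 \<in> carrier G" for k k1
  proof -
    have "set (map (\<lambda>i. tens_act G k (inv k1 [^] i) (k [^] (q - 1 - i))) [1..<q]) \<subseteq>
        carrier (tensor_free q G)" using that by auto
    then show "?l k k1 \<in> carrier (tensor_free q G)"
      and "f (?l k k1) = hat_expansion q G H (\<lambda>g h. f (tens g h)) k k1"
      by (simp_all only: f.G.list_mult_closed f.hom_list_mult)
        (simp add: hat_expansion_def tens_act_def comp_def)
  qed
  show "hat_relators q G \<subseteq> kernel (tensor_free q G) H f \<longleftrightarrow>
      hat_relations q G H (\<lambda>g h. f (tens g h)) (\<lambda>k. f (hat k))"
    unfolding hat_relators_def Let_def Un_subset_iff hat_relations_def conj_assoc collect2 collect3
    by (intro arg_cong2[where f = "(\<and>)"] ball_cong refl)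
      (simp_all add: f.relator_in_kernel_iff f.hom_conj_by f.hom_commutator f.hom_nat_pow
        l[simplified] f_l[simplified]
        tens_act_def[of G _ _ "_ [^] q"])
qed


lemma group_tensor_free [simp]: "group (tensor_free q H)"
  unfolding tensor_free_def by (rule group_free_group)

lemma tensor_kernel_normal:
  assumes "group G"
  shows "tensor_kernel q G \<lhd> tensor_free q G"
proof -
  interpret group G by (rule assms)
  interpret F: group "tensor_free q G" by simp
  have tens [simp]: "tens g h \<in> carrier (tensor_free q G)" if "g \<in> carrier G" "h \<in> carrier G" for g h
    using that by (simp add: tensor_free_def tensor_syms_def)
  have act [simp]: "tens_act G g h x \<in> carrier (tensor_free q G)"
    if "g \<in> carrier G" "h \<in> carrier G" "x \<in> carrier G" for g h x
    using that by (simp add: tens_act_def)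
  have hat [simp]: "hat g \<in> carrier (tensor_free q G)" if "0 < q" "g \<in> carrier G" for g
    using that by (simp add: tensor_free_def tensor_syms_def)
  have "tensor_relators q G \<subseteq> carrier (tensor_free q G)"
    by (auto simp: tensor_relators_def Let_def relator_def)
  moreover have "hat_relators q G \<subseteq> carrier (tensor_free q G)" if "0 < q"
    using that by (auto simp: hat_relators_def Let_def relator_def intro!: F.inv_closed F.m_closed F.list_mult_closed)
  ultimately show ?thesis
    unfolding tensor_kernel_def by (intro F.normal_closure_normal) auto
qed

definition tensor_hat :: "nat \<Rightarrow> ('a, 'm) monoid_scheme \<Rightarrow> 'a \<Rightarrow> 'a tensor_sym word set" where
  "tensor_hat q G k = tensor_kernel q G #>\<^bsub>tensor_free q G\<^esub> hat k"

definition exterior_hat :: "nat \<Rightarrow> ('a, 'm) monoid_scheme \<Rightarrow> 'a \<Rightarrow> 'a tensor_sym word set set" where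
  "exterior_hat q G k = nabla q G #>\<^bsub>tensor_square q G\<^esub> tensor_hat q G k"

lemma tensor_square_properties:
  assumes "group G"
  shows tensor_quotient_hom:
      "group_hom (tensor_free q G) (tensor_square q G) ((#>\<^bsub>tensor_free q G\<^esub>) (tensor_kernel q G))"
    and tensor_pairing_tensor: "tensor_pairing G (tensor_square q G) (tensor q G)"
    and hat_relations_tensor:
      "0 < q \<Longrightarrow> hat_relations q G (tensor_square q G) (tensor q G) (tensor_hat q G)"
proof -
  interpret group G by (rule assms)
  interpret N: normal "tensor_kernel q G" "tensor_free q G"
    using assms by (rule tensor_kernel_normal)
  show hom: "group_hom (tensor_free q G) (tensor_square q G)
      ((#>\<^bsub>tensor_free q G\<^esub>) (tensor_kernel q G))"
    unfolding tensor_square_def by (rule N.coset_hom)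
  interpret f: group_hom "tensor_free q G" "tensor_square q G"
      "(#>\<^bsub>tensor_free q G\<^esub>) (tensor_kernel q G)"
    by (rule hom)
  have kernel: "kernel (tensor_free q G) (tensor_square q G)
      ((#>\<^bsub>tensor_free q G\<^esub>) (tensor_kernel q G)) = tensor_kernel q G"
    unfolding tensor_square_def by (rule N.coset_kernel)
  have sub: "tensor_relators q G \<union> (if q = 0 then {} else hat_relators q G) \<subseteq> tensor_kernel q G"
    by (auto simp: tensor_kernel_def normal_closure_def)
  have "tens g h \<in> carrier (tensor_free q G)" if "g \<in> carrier G" "h \<in> carrier G" for g h
    using that by (simp add: tensor_free_def tensor_syms_def)
  then have "tensor q G g h \<in> carrier (tensor_square q G)"
    if "g \<in> carrier G" "h \<in> carrier G" for g h
    using that unfolding tensor_def by simp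
  moreover have "tensor_relations G (tensor_square q G) (tensor q G)"
    using sub tensor_relators_subset_kernel_iff[OF assms hom] unfolding kernel tensor_def[abs_def]
    by auto
  ultimately show "tensor_pairing G (tensor_square q G) (tensor q G)"
    by unfold_locales
  show "hat_relations q G (tensor_square q G) (tensor q G) (tensor_hat q G)" if "0 < q"
    using sub hat_relators_subset_kernel_iff[OF assms hom that] that
    unfolding kernel tensor_def[abs_def] tensor_hat_def[abs_def] by auto
qed

lemma tensor_square_subgroup_induct:
  assumes "group G" and K: "subgroup K (tensor_square q G)"
    and tensor: "\<And>g h. \<lbrakk>g \<in> carrier G; h \<in> carrier G\<rbrakk> \<Longrightarrow> tensor q G g h \<in> K"
    and hat: "\<And>k. \<lbrakk>0 < q; k \<in> carrier G\<rbrakk> \<Longrightarrow> tensor_hat q G k \<in> K"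
  shows "carrier (tensor_square q G) \<subseteq> K"
proof -
  interpret f: group_hom "tensor_free q G" "tensor_square q G"
      "(#>\<^bsub>tensor_free q G\<^esub>) (tensor_kernel q G)"
    using assms(1) by (rule tensor_quotient_hom)
  interpret K: subgroup K "tensor_square q G" by (rule K)
  let ?L = "{u \<in> carrier (tensor_free q G). tensor_kernel q G #>\<^bsub>tensor_free q G\<^esub> u \<in> K}"
  have "subgroup ?L (tensor_free q G)"
    by (rule f.G.subgroupI) auto
  moreover have "free_gen a \<in> ?L" if "a \<in> tensor_syms q G" for a
    using that tensor hat by (auto simp: tensor_syms_def tensor_free_def tensor_def tensor_hat_def split: if_splits)
  ultimately have "u \<in> ?L" if "u \<in> carrier (tensor_free q G)" for u
    using that unfolding tensor_free_def by (rule free_group_subgroup_induct)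
  then show ?thesis by (auto simp: tensor_square_def carrier_FactGroup)
qed

text \<open>Conjugation by \<open>x \<otimes> y\<close> and by the hat of \<open>k\<close> moves \<open>g \<otimes> g\<close> to \<open>g\<^sup>c \<otimes> g\<^sup>c\<close> with
  \<open>c = [x, y]\<close> and \<open>c = k\<^sup>q\<close> respectively; hence the generating set of \<open>\<nabla>\<close> is normalized.\<close>

lemma nabla_normal:
  assumes "group G"
  shows "nabla q G \<lhd> tensor_square q G"
proof -
  interpret w: tensor_pairing G "tensor_square q G" "tensor q G"
    using assms by (rule tensor_pairing_tensor)
  let ?T = "tensor_square q G"
  let ?X = "{tensor q G g g | g. g \<in> carrier G}"
  let ?K = "{t \<in> carrier ?T. \<exists>c\<in>carrier G. \<forall>g\<in>carrier G.
      conj_by ?T (tensor q G g g) t = tensor q G (conj_by G g c) (conj_by G g c)}"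
  \<comment> \<open>closed under inverses because conjugation by \<open>c\<close> permutes the squares \<open>g \<otimes> g\<close>\<close>
  have "subgroup ?K ?T"
  proof (rule w.T.subgroupI)
    fix t assume "t \<in> ?K"
    then obtain c where t: "t \<in> carrier ?T" "c \<in> carrier G"
      "\<And>g. g \<in> carrier G \<Longrightarrow> conj_by ?T (tensor q G g g) t = tensor q G (conj_by G g c) (conj_by G g c)"
      by auto
    have "conj_by ?T (tensor q G g g) (inv\<^bsub>?T\<^esub> t) =
        tensor q G (conj_by G g (inv\<^bsub>G\<^esub> c)) (conj_by G g (inv\<^bsub>G\<^esub> c))" if g: "g \<in> carrier G" for g
    proof -
      let ?g = "conj_by G g (inv\<^bsub>G\<^esub> c)"
      have "tensor q G g g = conj_by ?T (tensor q G ?g ?g) t"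
        using t g by (simp add: w.conj_by_conj_by)
      then show ?thesis using t(1,2) g by (simp add: w.T.conj_by_conj_by)
    qed
    then show "inv\<^bsub>?T\<^esub> t \<in> ?K" using t by auto
  next
    fix t u assume "t \<in> ?K" "u \<in> ?K"
    then obtain c d where t: "t \<in> carrier ?T" "c \<in> carrier G"
      "\<And>g. g \<in> carrier G \<Longrightarrow> conj_by ?T (tensor q G g g) t = tensor q G (conj_by G g c) (conj_by G g c)"
      and u: "u \<in> carrier ?T" "d \<in> carrier G"
      "\<And>g. g \<in> carrier G \<Longrightarrow> conj_by ?T (tensor q G g g) u = tensor q G (conj_by G g d) (conj_by G g d)"
      by blast
    have "conj_by ?T (tensor q G g g) (t \<otimes>\<^bsub>?T\<^esub> u) =
        tensor q G (conj_by G g (c \<otimes>\<^bsub>G\<^esub> d)) (conj_by G g (c \<otimes>\<^bsub>G\<^esub> d))" if "g \<in> carrier G" for g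
      using t u that by (simp flip: w.T.conj_by_conj_by w.conj_by_conj_by)
    then show "t \<otimes>\<^bsub>?T\<^esub> u \<in> ?K" using t u by blast
  qed (auto intro!: exI[of _ "\<one>\<^bsub>?T\<^esub>"] bexI[of _ "\<one>\<^bsub>G\<^esub>"])
  moreover have "tensor q G x y \<in> ?K" if "x \<in> carrier G" "y \<in> carrier G" for x y
    using that by (auto simp: w.conj_by_w intro!: bexI[of _ "commutator G x y"])
  moreover have "tensor_hat q G k \<in> ?K" if "0 < q" "k \<in> carrier G" for k
  proof -
    interpret f: group_hom "tensor_free q G" ?T "(#>\<^bsub>tensor_free q G\<^esub>) (tensor_kernel q G)"
      using assms by (rule tensor_quotient_hom)
    have "hat k \<in> carrier (tensor_free q G)"
      using that by (simp add: tensor_free_def tensor_syms_def)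
    then have "tensor_hat q G k \<in> carrier ?T" unfolding tensor_hat_def by simp
    then show ?thesis using that hat_relations_tensor[OF assms that(1)]
      by (auto simp: hat_relations_def intro!: bexI[of _ "k [^]\<^bsub>G\<^esub> q"])
  qed
  ultimately have sub: "carrier ?T \<subseteq> ?K"
    using assms by (intro tensor_square_subgroup_induct) auto
  show ?thesis unfolding nabla_def
  proof (rule w.T.normal_generateI)
    fix x t assume "x \<in> ?X" and t: "t \<in> carrier ?T"
    then obtain g where g: "g \<in> carrier G" "x = tensor q G g g" by blast
    have "inv\<^bsub>?T\<^esub> t \<in> ?K" using sub t by blast
    then obtain c where "c \<in> carrier G"
      "conj_by ?T x (inv\<^bsub>?T\<^esub> t) = tensor q G (conj_by G g c) (conj_by G g c)"
      using g by blast
    with g t show "t \<otimes>\<^bsub>?T\<^esub> x \<otimes>\<^bsub>?T\<^esub> inv\<^bsub>?T\<^esub> t \<in> ?X"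
      by (auto simp: conj_by_def)
  qed auto
qed

lemma exterior_quotient_hom:
  assumes "group G"
  shows "group_hom (tensor_square q G) (exterior_square q G) ((#>\<^bsub>tensor_square q G\<^esub>) (nabla q G))"
  unfolding exterior_square_def by (rule normal.coset_hom[OF nabla_normal[OF assms]])

lemma q_exterior_pairing_exterior:
  assumes "group G"
  shows "q_exterior_pairing G (exterior_square q G) (exterior q G) q (exterior_hat q G)"
proof -
  interpret w: tensor_pairing G "tensor_square q G" "tensor q G"
    using assms by (rule tensor_pairing_tensor)
  interpret N: normal "nabla q G" "tensor_square q G"
    using assms by (rule nabla_normal)
  interpret f: group_hom "tensor_free q G" "tensor_square q G"
      "(#>\<^bsub>tensor_free q G\<^esub>) (tensor_kernel q G)"
    using assms by (rule tensor_quotient_hom)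
  interpret g: group_hom "tensor_square q G" "exterior_square q G"
      "(#>\<^bsub>tensor_square q G\<^esub>) (nabla q G)"
    using assms by (rule exterior_quotient_hom)
  let ?f = "\<lambda>u. nabla q G #>\<^bsub>tensor_square q G\<^esub> (tensor_kernel q G #>\<^bsub>tensor_free q G\<^esub> u)"
  have hom: "group_hom (tensor_free q G) (exterior_square q G) ?f"
    using f.homh g.homh by unfold_locales (auto simp: hom_def)
  have sub: "kernel (tensor_free q G) (tensor_square q G)
      ((#>\<^bsub>tensor_free q G\<^esub>) (tensor_kernel q G)) \<subseteq> kernel (tensor_free q G) (exterior_square q G) ?f"
    by (auto simp: kernel_def)
  have tens: "tens g h \<in> carrier (tensor_free q G)" if "g \<in> carrier G" "h \<in> carrier G" for g h
    using that by (simp add: tensor_free_def tensor_syms_def)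
  show ?thesis
  proof
    show "exterior q G g h \<in> carrier (exterior_square q G)" if "g \<in> carrier G" "h \<in> carrier G" for g h
      using that by (simp add: exterior_def)
    show "tensor_relations G (exterior_square q G) (exterior q G)"
      using tensor_relators_subset_kernel_iff[OF assms f.group_hom_axioms] w.w_relations
        tensor_relators_subset_kernel_iff[OF assms hom] sub
      unfolding exterior_def[abs_def] tensor_def[abs_def] by blast
    show "exterior q G g g = \<one>\<^bsub>exterior_square q G\<^esub>" if "g \<in> carrier G" for g
    proof -
      have "tensor q G g g \<in> nabla q G"
        using that unfolding nabla_def by (intro generate.incl) auto
      then show ?thesis
        using w.T.coset_join2[OF _ N.subgroup_axioms] that w.w_closed
        by (simp add: exterior_def exterior_square_def)
    qed
    assume q: "0 < q"
    show "exterior_hat q G k \<in> carrier (exterior_square q G)" if "k \<in> carrier G" for k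
    proof -
      have "hat k \<in> carrier (tensor_free q G)"
        using that q by (simp add: tensor_free_def tensor_syms_def)
      then show ?thesis unfolding exterior_hat_def tensor_hat_def by simp
    qed
    show "hat_relations q G (exterior_square q G) (exterior q G) (exterior_hat q G)"
      using hat_relators_subset_kernel_iff[OF assms f.group_hom_axioms q]
        hat_relations_tensor[OF assms q]
        hat_relators_subset_kernel_iff[OF assms hom q] sub
      unfolding exterior_def[abs_def] tensor_def[abs_def] exterior_hat_def[abs_def]
        tensor_hat_def[abs_def] by blast
  qed
qed

text \<open>Evaluation of words kills the relators because \<open>w\<close> and \<open>hatv\<close> satisfy the relations, and then
  \<open>\<nabla>\<close> because \<open>w g g\<close> is trivial.\<close>

lemma (in q_exterior_pairing) exterior_square_universal:
  obtains \<phi> where "group_hom (exterior_square q G) T \<phi>"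
    and "\<And>g h. \<lbrakk>g \<in> carrier G; h \<in> carrier G\<rbrakk> \<Longrightarrow> \<phi> (exterior q G g h) = w g h"
proof -
  let ?v = "\<lambda>s. case s of Tens g h \<Rightarrow> w g h | Hat k \<Rightarrow> hatv k"
  let ?f = "word_value T ?v"
  have v: "?v s \<in> carrier T" if "s \<in> tensor_syms q G" for s
    using that hat_closed by (auto simp: tensor_syms_def split: if_splits)
  have hom: "group_hom (tensor_free q G) T ?f"
    unfolding tensor_free_def by (rule T.word_value_hom) (rule v)
  interpret f: group_hom "tensor_free q G" T ?f by (rule hom)
  have f_tens: "?f (tens g h) = w g h" if "g \<in> carrier G" "h \<in> carrier G" for g h
    using that by simp
  have f_hat: "?f (hat k) = hatv k" if "0 < q" "k \<in> carrier G" for k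
    using that hat_closed by simp
  have "tensor_relations G T (\<lambda>g h. ?f (tens g h))"
    using w_relations by (simp add: tensor_relations_def f_tens)
  moreover have "hat_relations q G T (\<lambda>g h. ?f (tens g h)) (\<lambda>k. ?f (hat k))" if "0 < q"
  proof -
    have "hat_expansion q G T (\<lambda>g h. ?f (tens g h)) k k1 = hat_expansion q G T w k k1"
      if "k \<in> carrier G" "k1 \<in> carrier G" for k k1
      using that by (simp add: hat_expansion_def f_tens)
    then show ?thesis using hat_relations[OF that]
      by (simp add: hat_relations_def f_tens f_hat that)
  qed
  ultimately have "tensor_kernel q G \<subseteq> kernel (tensor_free q G) T ?f"
    unfolding tensor_kernel_def
    using tensor_relators_subset_kernel_iff[OF is_group hom] hat_relators_subset_kernel_iff[OF is_group hom]
    by (intro f.normal_closure_subset_kernel) auto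
  from f.FactGroup_universal_kernel[OF tensor_kernel_normal[OF is_group] this]
  obtain \<psi> where \<psi>: "\<psi> \<in> hom (tensor_square q G) T"
    "\<And>u. u \<in> carrier (tensor_free q G) \<Longrightarrow> \<psi> (tensor_kernel q G #>\<^bsub>tensor_free q G\<^esub> u) = ?f u"
    by (auto simp: tensor_square_def)
  interpret t: tensor_pairing G "tensor_square q G" "tensor q G"
    using is_group by (rule tensor_pairing_tensor)
  interpret \<psi>: group_hom "tensor_square q G" T \<psi>
    using \<psi>(1) by unfold_locales
  have \<psi>_tensor: "\<psi> (tensor q G g h) = w g h" if "g \<in> carrier G" "h \<in> carrier G" for g h
    unfolding tensor_def using that f_tens
    by (subst \<psi>(2)) (auto simp: tensor_free_def tensor_syms_def)
  have "nabla q G \<subseteq> kernel (tensor_square q G) T \<psi>"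
    unfolding nabla_def by (rule t.T.generate_subgroup_incl[OF _ \<psi>.subgroup_kernel])
      (auto simp: kernel_def \<psi>_tensor)
  from \<psi>.FactGroup_universal_kernel[OF nabla_normal[OF is_group] this]
  obtain \<phi> where \<phi>: "\<phi> \<in> hom (exterior_square q G) T"
    "\<And>t. t \<in> carrier (tensor_square q G) \<Longrightarrow> \<phi> (nabla q G #>\<^bsub>tensor_square q G\<^esub> t) = \<psi> t"
    by (auto simp: exterior_square_def)
  interpret e: q_exterior_pairing G "exterior_square q G" "exterior q G" q "exterior_hat q G"
    using is_group by (rule q_exterior_pairing_exterior)
  show thesis
  proof
    show "group_hom (exterior_square q G) T \<phi>"
      using \<phi>(1) by unfold_locales
    show "\<phi> (exterior q G g h) = w g h" if "g \<in> carrier G" "h \<in> carrier G" for g h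
      using that by (simp add: exterior_def \<phi>(2) \<psi>_tensor)
  qed
qed

section \<open>Commutators and powers in \<open>q\<close>-central extensions\<close>

locale q_central_extension = E: group E + G: group G + group_hom E G p for E (structure) and G (structure) and p +
  fixes q :: nat
  assumes surj: "p ` carrier E = carrier G"
    and kernel_central: "\<lbrakk>z \<in> carrier E; p z = \<one>\<^bsub>G\<^esub>; x \<in> carrier E\<rbrakk> \<Longrightarrow> z \<otimes> x = x \<otimes> z"
    and kernel_exponent: "\<lbrakk>z \<in> carrier E; p z = \<one>\<^bsub>G\<^esub>\<rbrakk> \<Longrightarrow> z [^] q = \<one>"
begin

lemma same_image_obtains:
  assumes "x \<in> carrier E" "y \<in> carrier E" "p x = p y"
  obtains z where "z \<in> carrier E" "p z = \<one>\<^bsub>G\<^esub>" "x = z \<otimes> y"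
proof
  show "x = (x \<otimes> inv y) \<otimes> y" using assms by (simp add: E.m_assoc)
qed (use assms in simp_all)

text \<open>A change of lifts multiplies \<open>x\<close> and \<open>y\<close> by central elements, which cancel in the
  commutator.\<close>

lemma commutator_cong:
  assumes "x \<in> carrier E" "x' \<in> carrier E" "y \<in> carrier E" "y' \<in> carrier E"
    and "p x = p x'" "p y = p y'"
  shows "commutator E x y = commutator E x' y'"
proof -
  obtain u where u: "u \<in> carrier E" "p u = \<one>\<^bsub>G\<^esub>" "x = u \<otimes> x'"
    using assms same_image_obtains by metis
  obtain v where v: "v \<in> carrier E" "p v = \<one>\<^bsub>G\<^esub>" "y = v \<otimes> y'"
    using assms same_image_obtains by metis
  have uc: "a \<otimes> (u \<otimes> b) = u \<otimes> (a \<otimes> b)" if "a \<in> carrier E" "b \<in> carrier E" for a b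
    using kernel_central[OF u(1,2)] u(1) that by (metis E.m_assoc)
  have vc: "a \<otimes> (v \<otimes> b) = v \<otimes> (a \<otimes> b)" if "a \<in> carrier E" "b \<in> carrier E" for a b
    using kernel_central[OF v(1,2)] v(1) that by (metis E.m_assoc)
  have "commutator E x y = inv x' \<otimes> (inv u \<otimes> (inv y' \<otimes> (inv v \<otimes> (u \<otimes> (x' \<otimes> (v \<otimes> y'))))))"
    using assms u v by (simp add: commutator_def E.m_assoc E.inv_mult_group)
  also have "x' \<otimes> (v \<otimes> y') = v \<otimes> (x' \<otimes> y')" using vc assms by simp
  also have "u \<otimes> (v \<otimes> (x' \<otimes> y')) = v \<otimes> (u \<otimes> (x' \<otimes> y'))" using vc u assms by simp
  also have "inv v \<otimes> (v \<otimes> (u \<otimes> (x' \<otimes> y'))) = u \<otimes> (x' \<otimes> y')" using v u assms by simp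
  also have "inv y' \<otimes> (u \<otimes> (x' \<otimes> y')) = u \<otimes> (inv y' \<otimes> (x' \<otimes> y'))" using uc assms by simp
  finally show ?thesis using u assms by (simp add: commutator_def E.m_assoc)
qed

lemma power_cong:
  assumes "x \<in> carrier E" "y \<in> carrier E" "p x = p y"
  shows "x [^] q = y [^] q"
proof -
  obtain z where z: "z \<in> carrier E" "p z = \<one>\<^bsub>G\<^esub>" "x = z \<otimes> y"
    using assms same_image_obtains by metis
  then show ?thesis
    using E.pow_mult_distrib[OF kernel_central[OF z(1,2) assms(2)] z(1) assms(2), of q]
      kernel_exponent[OF z(1,2)] assms(2) by simp
qed

text \<open>The product rules are the commutator identities for products, the relation for the hat of a
  product is \<open>power_mult_expand\<close>, and the others become trivial because commutators and \<open>q\<close>-th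
  powers may be computed with any lifts.\<close>

lemma q_exterior_pairing_commutator:
  assumes l: "\<And>g. g \<in> carrier G \<Longrightarrow> l g \<in> carrier E \<and> p (l g) = g"
  shows "q_exterior_pairing G E (\<lambda>g h. commutator E (l g) (l h)) q (\<lambda>k. l k [^] q)"
proof -
  have lift: "commutator E (l (p x)) (l (p y)) = commutator E x y" "l (p x) [^] q = x [^] q"
    if "x \<in> carrier E" "y \<in> carrier E" for x y
    using that l by (auto intro!: commutator_cong power_cong)
  have lc [simp]: "l (p x) \<in> carrier E" if "x \<in> carrier E" for x using l that by simp
  have ball: "(\<forall>g\<in>carrier G. P g) \<longleftrightarrow> (\<forall>x\<in>carrier E. P (p x))" for P
    by (simp flip: surj)
  have comm_conj: "commutator E (conj_by E x z) (conj_by E y z) = conj_by E (commutator E x y) z"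
    if "x \<in> carrier E" "y \<in> carrier E" "z \<in> carrier E" for x y z
    using group_hom.hom_commutator[OF E.conj_by_hom] that by simp
  let ?w = "\<lambda>g h. commutator E (l g) (l h)"
  have w: "?w (conj_by G (p x) (p z)) (conj_by G (p y) (p z)) = conj_by E (commutator E x y) z"
    if "x \<in> carrier E" "y \<in> carrier E" "z \<in> carrier E" for x y z
    using that by (simp add: lift comm_conj flip: hom_conj_by)
  have "hat_expansion q G E ?w (p x) (p y) =
      list_mult E (map (\<lambda>i. conj_by E (commutator E x (inv y [^] i)) (x [^] (q - 1 - i))) [1..<q])"
    if "x \<in> carrier E" "y \<in> carrier E" for x y
    unfolding hat_expansion_def using that
    by (intro arg_cong[where f = "list_mult E"] map_cong refl)
      (simp add: w flip: hom_nat_pow hom_inv)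
  then have "hat_relations q G E ?w (\<lambda>k. l k [^] q)"
    unfolding hat_relations_def ball
    by (auto simp: lift w E.power_mult_expand[simplified] simp flip: hom_mult hom_nat_pow hom_commutator)
  moreover have "tensor_relations G E ?w"
    unfolding tensor_relations_def ball
    by (auto simp: lift w simp flip: hom_mult)
      (simp_all add: commutator_def conj_by_def E.m_assoc E.inv_mult_group)
  ultimately show ?thesis
    using l by unfold_locales (auto simp: commutator_def E.m_assoc)
qed

text \<open>The homomorphism from the exterior square to \<open>E\<close> sends \<open>p x \<and> p y\<close> to \<open>[x, y]\<close>.\<close>

lemma wedge_trivial_imp_center:
  assumes x: "x \<in> carrier E" and "p x \<in> exterior_center q G"
  shows "x \<in> group_center E"
proof -
  define l where "l = inv_into (carrier E) p"
  have l: "l g \<in> carrier E \<and> p (l g) = g" if "g \<in> carrier G" for g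
    unfolding l_def using that surj by (metis inv_into_into f_inv_into_f)
  interpret w: q_exterior_pairing G E "\<lambda>g h. commutator E (l g) (l h)" q "\<lambda>k. l k [^] q"
    using l by (rule q_exterior_pairing_commutator)
  obtain \<phi> where \<phi>: "group_hom (exterior_square q G) E \<phi>"
    "\<And>g h. \<lbrakk>g \<in> carrier G; h \<in> carrier G\<rbrakk> \<Longrightarrow> \<phi> (exterior q G g h) = commutator E (l g) (l h)"
    using w.exterior_square_universal by blast
  have "x \<otimes> y = y \<otimes> x" if y: "y \<in> carrier E" for y
  proof -
    have "\<phi> (exterior q G (p x) (p y)) = \<one>"
      using assms y group_hom.hom_one[OF \<phi>(1)] by (simp add: exterior_center_def)
    moreover have "commutator E (l (p x)) (l (p y)) = commutator E x y"
      using x y l by (intro commutator_cong) auto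
    ultimately have "commutator E x y = \<one>" using \<phi>(2) x y by simp
    moreover have "x \<otimes> y = y \<otimes> x \<otimes> commutator E x y"
      using x y by (simp add: commutator_def E.m_assoc)
    ultimately show ?thesis using x y by simp
  qed
  then show ?thesis using x by (simp add: group_center_def)
qed

end

section \<open>The extension \<open>E\<^sub>q(G)\<close>\<close>


context normal
begin

lemma power_subgroup_normal: "power_subgroup G q H \<lhd> G"
  unfolding power_subgroup_def
proof (rule normal_generateI)
  show "{x [^] q | x. x \<in> H} \<subseteq> carrier G" using subset by auto
next
  fix h g assume "h \<in> {x [^] q | x. x \<in> H}" and g: "g \<in> carrier G"
  then obtain x where x: "x \<in> H" "h = x [^] q" by blast
  interpret c: group_hom G G "\<lambda>z. conj_by G z (inv g)" using g by (intro conj_by_hom) simp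
  have "g \<otimes> h \<otimes> inv g = (g \<otimes> x \<otimes> inv g) [^] q"
    using c.hom_nat_pow[of x q] x g subset by (auto simp: conj_by_def)
  then show "g \<otimes> h \<otimes> inv g \<in> {x [^] q | x. x \<in> H}"
    using inv_op_closed2[OF g x(1)] by blast
qed

lemma commutator_subgroup_normal: "commutator_subgroup G (carrier G) H \<lhd> G"
  unfolding commutator_subgroup_def
proof (rule normal_generateI)
  show "{commutator G x y | x y. x \<in> carrier G \<and> y \<in> H} \<subseteq> carrier G" using subset by auto
next
  fix h g assume "h \<in> {commutator G x y | x y. x \<in> carrier G \<and> y \<in> H}" and g: "g \<in> carrier G"
  then obtain x y where xy: "x \<in> carrier G" "y \<in> H" "h = commutator G x y" by blast
  interpret c: group_hom G G "\<lambda>z. conj_by G z (inv g)" using g by (intro conj_by_hom) simp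
  have "g \<otimes> h \<otimes> inv g = commutator G (g \<otimes> x \<otimes> inv g) (g \<otimes> y \<otimes> inv g)"
    using c.hom_commutator[of x y] xy g subset by (auto simp: conj_by_def)
  then show "g \<otimes> h \<otimes> inv g \<in> {commutator G x y | x y. x \<in> carrier G \<and> y \<in> H}"
    using inv_op_closed2[OF g xy(2)] xy(1) g by blast
qed

lemma q_cover_kernel_normal: "q_cover_kernel q G H \<lhd> G"
  unfolding q_cover_kernel_def
  by (intro normal_subgroup_set_mult_closed power_subgroup_normal commutator_subgroup_normal)

lemma q_cover_kernel_memI:
  shows power_in_q_cover_kernel: "r \<in> H \<Longrightarrow> r [^] q \<in> q_cover_kernel q G H"
    and commutator_in_q_cover_kernel:
      "\<lbrakk>x \<in> carrier G; r \<in> H\<rbrakk> \<Longrightarrow> commutator G x r \<in> q_cover_kernel q G H"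
proof -
  have "\<one> \<in> power_subgroup G q H" "\<one> \<in> commutator_subgroup G (carrier G) H"
    by (auto simp: power_subgroup_def commutator_subgroup_def generate.one)
  moreover have "r [^] q \<in> power_subgroup G q H" if "r \<in> H"
    unfolding power_subgroup_def using that by (intro generate.incl) auto
  moreover have "commutator G x r \<in> commutator_subgroup G (carrier G) H"
    if "x \<in> carrier G" "r \<in> H"
    unfolding commutator_subgroup_def using that by (intro generate.incl) auto
  ultimately show "r \<in> H \<Longrightarrow> r [^] q \<in> q_cover_kernel q G H"
    and "\<lbrakk>x \<in> carrier G; r \<in> H\<rbrakk> \<Longrightarrow> commutator G x r \<in> q_cover_kernel q G H"
    unfolding q_cover_kernel_def set_mult_def using subset
    by (force intro: r_one[symmetric] l_one[symmetric])+
qed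

lemma q_central_extension_q_cover:
  "q_central_extension (q_cover q G H) (G Mod H) (q_cover_epi G H) q"
proof -
  let ?K = "q_cover_kernel q G H" and ?p = "q_cover_epi G H"
  interpret K: normal ?K G by (rule q_cover_kernel_normal)
  interpret k: group_hom G "q_cover q G H" "(#>) ?K"
    unfolding q_cover_def by (rule K.coset_hom)
  interpret r: group_hom G "G Mod H" "(#>) H" by (rule coset_hom)
  have carrier: "carrier (q_cover q G H) = (#>) ?K ` carrier G"
    by (simp add: q_cover_def carrier_FactGroup)
  have epi: "?p (?K #> x) = H #> x" if "x \<in> carrier G" for x
    using that normal_axioms by (rule q_cover_epi_coset[rotated])
  have kernel: "x \<in> H" if "x \<in> carrier G" "H #> x = \<one>\<^bsub>G Mod H\<^esub>" for x
    using that coset_kernel by (auto simp: kernel_def)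
  have one: "?K #> x = \<one>\<^bsub>q_cover q G H\<^esub>" if "x \<in> ?K" for x
    using that K.coset_kernel by (auto simp: kernel_def q_cover_def)
  have hom: "?p \<in> hom (q_cover q G H) (G Mod H)"
  proof (rule homI)
    fix X Y assume "X \<in> carrier (q_cover q G H)" "Y \<in> carrier (q_cover q G H)"
    then obtain x y where xy: "x \<in> carrier G" "X = ?K #> x" "y \<in> carrier G" "Y = ?K #> y"
      by (auto simp: carrier)
    then show "?p X \<in> carrier (G Mod H)" by (simp only: epi r.hom_closed)
    have "X \<otimes>\<^bsub>q_cover q G H\<^esub> Y = ?K #> (x \<otimes> y)" using xy by (simp only: k.hom_mult)
    then show "?p (X \<otimes>\<^bsub>q_cover q G H\<^esub> Y) = ?p X \<otimes>\<^bsub>G Mod H\<^esub> ?p Y"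
      using xy by (simp only: epi r.hom_mult m_closed)
  qed
  show ?thesis
  proof (intro q_central_extension.intro group_hom.intro group_hom_axioms.intro
      q_central_extension_axioms.intro hom k.H.is_group r.H.is_group)
    show "?p ` carrier (q_cover q G H) = carrier (G Mod H)"
      by (simp add: carrier carrier_FactGroup image_image epi cong: image_cong)
  next
    fix Z X assume ZX: "Z \<in> carrier (q_cover q G H)" "?p Z = \<one>\<^bsub>G Mod H\<^esub>" "X \<in> carrier (q_cover q G H)"
    then obtain z x where z: "z \<in> carrier G" "Z = ?K #> z" and x: "x \<in> carrier G" "X = ?K #> x"
      by (auto simp only: carrier)
    with ZX have "z \<in> H" by (simp only: epi kernel)
    have "Z \<otimes>\<^bsub>q_cover q G H\<^esub> X = ?K #> (z \<otimes> x)" using x z by (simp only: k.hom_mult)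
    moreover have "X \<otimes>\<^bsub>q_cover q G H\<^esub> Z = ?K #> (x \<otimes> z)" using x z by (simp only: k.hom_mult)
    moreover have "x \<otimes> z = z \<otimes> x \<otimes> commutator G x z"
      using x z by (simp add: commutator_def m_assoc)
    moreover have "?K #> (z \<otimes> x \<otimes> commutator G x z) = ?K #> (z \<otimes> x)"
      using x z one[OF commutator_in_q_cover_kernel[OF x(1) \<open>z \<in> H\<close>]]
      by (simp only: k.hom_mult k.H.r_one k.H.m_closed m_closed commutator_closed k.hom_closed)
    ultimately show "Z \<otimes>\<^bsub>q_cover q G H\<^esub> X = X \<otimes>\<^bsub>q_cover q G H\<^esub> Z" by simp
  next
    fix Z assume Z: "Z \<in> carrier (q_cover q G H)" "?p Z = \<one>\<^bsub>G Mod H\<^esub>"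
    then obtain z where z: "z \<in> carrier G" "Z = ?K #> z"
      by (auto simp only: carrier)
    with Z have "z \<in> H" by (simp only: epi kernel)
    have "Z [^]\<^bsub>q_cover q G H\<^esub> q = ?K #> (z [^] q)" using z by (simp only: k.hom_nat_pow)
    then show "Z [^]\<^bsub>q_cover q G H\<^esub> q = \<one>\<^bsub>q_cover q G H\<^esub>"
      using power_in_q_cover_kernel[OF \<open>z \<in> H\<close>] one by simp
  qed
qed

end

section \<open>Equivariant exterior pairings\<close>

text \<open>Only the values of \<open>act x\<close> on the subgroup \<open>W\<close> generated by the wedge products are prescribed,
  and only there \<open>act\<close> is used as an action of \<open>G\<close>.\<close>

locale equivariant_exterior_pairing = q_exterior_pairing +
  fixes act :: "'a \<Rightarrow> 'c \<Rightarrow> 'c"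
  assumes act_group_hom: "x \<in> carrier G \<Longrightarrow> group_hom T T (act x)"
    and act_w: "\<lbrakk>x \<in> carrier G; g \<in> carrier G; h \<in> carrier G\<rbrakk> \<Longrightarrow>
      act x (w g h) = w (conj_by G g x) (conj_by G h x)"
begin

definition W :: "'c set" where
  "W = generate T {w g h | g h. g \<in> carrier G \<and> h \<in> carrier G}"

lemma W_subgroup: "subgroup W T"
  unfolding W_def by (rule T.generate_is_subgroup) auto

sublocale W: subgroup W T
  by (rule W_subgroup)

lemma w_in_W [simp]: "\<lbrakk>g \<in> carrier G; h \<in> carrier G\<rbrakk> \<Longrightarrow> w g h \<in> W"
  unfolding W_def by (auto intro: generate.incl)

text \<open>The identities on \<open>W\<close> below equate two homomorphisms, hence need checking on the wedge
  products only.\<close>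

lemma W_hom_eqI:
  assumes "group_hom T H f1" "group_hom T H f2"
    and "\<And>g h. \<lbrakk>g \<in> carrier G; h \<in> carrier G\<rbrakk> \<Longrightarrow> f1 (w g h) = f2 (w g h)"
    and t: "t \<in> W"
  shows "f1 t = f2 t"
proof -
  interpret f1: group_hom T H f1 by (rule assms(1))
  interpret f2: group_hom T H f2 by (rule assms(2))
  have "subgroup {t \<in> carrier T. f1 t = f2 t} T"
    by (rule T.subgroupI) auto
  then have "W \<subseteq> {t \<in> carrier T. f1 t = f2 t}"
    unfolding W_def by (rule T.generate_subgroup_incl[rotated]) (auto simp: assms(3))
  with t show ?thesis by auto
qed

lemma act_simps [simp]:
  assumes "x \<in> carrier G"
  shows act_closed: "t \<in> carrier T \<Longrightarrow> act x t \<in> carrier T"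
    and act_mult: "\<lbrakk>t \<in> carrier T; u \<in> carrier T\<rbrakk> \<Longrightarrow> act x (t \<otimes>\<^bsub>T\<^esub> u) = act x t \<otimes>\<^bsub>T\<^esub> act x u"
    and act_inv: "t \<in> carrier T \<Longrightarrow> act x (inv\<^bsub>T\<^esub> t) = inv\<^bsub>T\<^esub> act x t"
proof -
  interpret group_hom T T "act x" using assms by (rule act_group_hom)
  show "t \<in> carrier T \<Longrightarrow> act x t \<in> carrier T"
    and "\<lbrakk>t \<in> carrier T; u \<in> carrier T\<rbrakk> \<Longrightarrow> act x (t \<otimes>\<^bsub>T\<^esub> u) = act x t \<otimes>\<^bsub>T\<^esub> act x u"
    and "t \<in> carrier T \<Longrightarrow> act x (inv\<^bsub>T\<^esub> t) = inv\<^bsub>T\<^esub> act x t"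
    by simp_all
qed

lemma act_in_W [simp]:
  assumes x: "x \<in> carrier G" and t: "t \<in> W"
  shows "act x t \<in> W"
proof -
  interpret a: group_hom T T "act x" using x by (rule act_group_hom)
  have "subgroup {t \<in> carrier T. act x t \<in> W} T"
    by (rule T.subgroupI) auto
  then have "W \<subseteq> {t \<in> carrier T. act x t \<in> W}"
    unfolding W_def by (rule T.generate_subgroup_incl[rotated])
      (auto simp: act_w x simp flip: W_def)
  with t show ?thesis by auto
qed

lemma act_act:
  assumes "x \<in> carrier G" "y \<in> carrier G" "t \<in> W"
  shows "act y (act x t) = act (x \<otimes> y) t"
proof -
  have "group_hom T T (\<lambda>t. act y (act x t))"
    using assms by unfold_locales (auto simp: hom_def)
  moreover have "group_hom T T (act (x \<otimes> y))"
    using assms by (intro act_group_hom) simp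
  ultimately show ?thesis
    by (rule W_hom_eqI[OF _ _ _ assms(3)]) (simp add: assms act_w conj_by_conj_by)
qed

lemma act_one:
  assumes "t \<in> W"
  shows "act \<one> t = t"
proof -
  have "group_hom T T (\<lambda>t. t)" by unfold_locales (auto simp: hom_def)
  from W_hom_eqI[OF act_group_hom[OF one_closed] this _ assms] show ?thesis
    by (simp add: act_w)
qed

lemma crossed_W:
  assumes g: "g \<in> carrier G" "h \<in> carrier G" and t: "t \<in> W"
  shows "w g h \<otimes>\<^bsub>T\<^esub> act (g \<otimes> h) t = act (h \<otimes> g) t \<otimes>\<^bsub>T\<^esub> w g h"
proof -
  interpret c: group_hom T T "\<lambda>t. conj_by T t (w g h)" using g by (intro T.conj_by_hom) simp
  have hom: "group_hom T T (\<lambda>t. conj_by T (act (h \<otimes> g) t) (w g h))"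
    using g by unfold_locales (auto simp: hom_def T.conj_by_mult)
  have "act (g \<otimes> h) t = conj_by T (act (h \<otimes> g) t) (w g h)"
  proof (rule W_hom_eqI[OF _ hom _ t])
    show "group_hom T T (act (g \<otimes> h))" using g by (intro act_group_hom) simp
    fix x y assume xy: "x \<in> carrier G" "y \<in> carrier G"
    show "act (g \<otimes> h) (w x y) = conj_by T (act (h \<otimes> g) (w x y)) (w g h)"
      using xy g crossed_identity[of x y g h, symmetric]
      by (simp add: act_w conj_by_def[of T] T.m_assoc)
  qed
  then show ?thesis using g t by (simp add: conj_by_def T.m_assoc)
qed

lemma w_inv_left:
  assumes "x \<in> carrier G" "y \<in> carrier G"
  shows "w (inv x) y = act (inv x) (inv\<^bsub>T\<^esub> w x y)"
proof -
  have "act (inv x) (w x y) \<otimes>\<^bsub>T\<^esub> w (inv x) y = \<one>\<^bsub>T\<^esub>"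
    using w_mult_left[of x "inv x" y] assms by (simp add: act_w)
  from T.inv_equality[OF this] have "act (inv x) (w x y) = inv\<^bsub>T\<^esub> w (inv x) y"
    using assms by simp
  then show ?thesis using assms by simp
qed

lemma w_inv_right:
  assumes "x \<in> carrier G" "y \<in> carrier G"
  shows "w x (inv y) = act (inv y) (inv\<^bsub>T\<^esub> w x y)"
proof -
  have "\<one>\<^bsub>T\<^esub> = w x (inv y) \<otimes>\<^bsub>T\<^esub> act (inv y) (w x y)"
    using w_mult_right[of x y "inv y"] assms by (simp add: act_w)
  then show ?thesis using assms by (simp add: T.inv_equality)
qed

text \<open>Expand \<open>w (z y) (z y) = 1\<close>: the terms of the form \<open>w g g\<close> drop out and
  \<open>w (z\<^sup>y) y \<cdot> w y (z\<^sup>y) = 1\<close> remains.\<close>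

lemma w_swap:
  assumes "x \<in> carrier G" "y \<in> carrier G"
  shows "w y x = inv\<^bsub>T\<^esub> w x y"
proof -
  have "w x y \<otimes>\<^bsub>T\<^esub> w y x = \<one>\<^bsub>T\<^esub>" if "x = conj_by G z y" "z \<in> carrier G" for z
  proof -
    have "w (z \<otimes> y) (z \<otimes> y) = w x y \<otimes>\<^bsub>T\<^esub> w y x"
      using that assms by (subst w_mult_left) (simp_all add: w_mult_right conj_by_mult T.m_assoc
        conj_by_def[of G y y])
    then show ?thesis using that assms by simp
  qed
  from this[of "conj_by G x (inv y)"] have "w x y \<otimes>\<^bsub>T\<^esub> w y x = \<one>\<^bsub>T\<^esub>"
    using assms by (simp add: conj_by_conj_by)
  then show ?thesis using assms T.inv_equality[of "w y x" "w x y"] T.inv_comm by simp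
qed

text \<open>Write \<open>[x, y] = x\<^sup>-\<^sup>1 x\<^sup>y\<close> and expand: the second factor contributes
  \<open>x\<^sup>y \<and> g = (x \<and> y)\<^sup>-\<^sup>1 (x \<and> g) (x \<and> y)\<^sup>g\<close>, and the first one is the conjugate of
  \<open>(x \<and> g)\<^sup>-\<^sup>1\<close> by \<open>x \<and> y\<close>.\<close>

lemma w_commutator:
  assumes x: "x \<in> carrier G" and y: "y \<in> carrier G" and g: "g \<in> carrier G"
  shows "w (commutator G x y) g = inv\<^bsub>T\<^esub> w x y \<otimes>\<^bsub>T\<^esub> act g (w x y)"
proof -
  \<comment> \<open>the second factor, by writing \<open>x\<^sup>y \<and> g\<close> as the conjugate by \<open>y\<close> of \<open>x \<and> y g y\<^sup>-\<^sup>1\<close>\<close>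
  have "w (conj_by G x y) g = act y (w x (y \<otimes> g \<otimes> inv y))"
    using assms by (simp add: act_w conj_by_def[of G "_ \<otimes> _"] m_assoc)
  also have "w x (y \<otimes> g \<otimes> inv y) = w x (inv y) \<otimes>\<^bsub>T\<^esub> act (inv y) (w x g \<otimes>\<^bsub>T\<^esub> act g (w x y))"
    using assms by (simp add: w_mult_right[of x "y \<otimes> g"] w_mult_right[of x y g] flip: act_w)
  also have "act y \<dots> = inv\<^bsub>T\<^esub> w x y \<otimes>\<^bsub>T\<^esub> (w x g \<otimes>\<^bsub>T\<^esub> act g (w x y))"
    using assms by (simp add: w_inv_right act_act act_one del: act_inv act_mult)
      (simp add: act_act act_one m_assoc del: act_inv)
  finally have 1: "w (conj_by G x y) g = inv\<^bsub>T\<^esub> w x y \<otimes>\<^bsub>T\<^esub> (w x g \<otimes>\<^bsub>T\<^esub> act g (w x y))" .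
  have c: "commutator G x y = inv x \<otimes> conj_by G x y"
    using assms by (simp add: commutator_def conj_by_def m_assoc)
  have "w (commutator G x y) g = act (conj_by G x y) (w (inv x) g) \<otimes>\<^bsub>T\<^esub> w (conj_by G x y) g"
    unfolding c using assms by (simp add: w_mult_left act_w)
  also have "act (conj_by G x y) (w (inv x) g) = act (inv (y \<otimes> x) \<otimes> (x \<otimes> y)) (inv\<^bsub>T\<^esub> w x g)"
    using assms by (simp add: w_inv_left act_act conj_by_def m_assoc inv_mult_group del: act_inv)
  also have "\<dots> = conj_by T (inv\<^bsub>T\<^esub> w x g) (w x y)"
    using assms crossed_W[OF x y, of "act (inv (y \<otimes> x)) (inv\<^bsub>T\<^esub> w x g)", symmetric]
    by (simp add: act_act act_one conj_by_def[of T] T.m_assoc del: act_inv)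
  finally show ?thesis using assms 1 by (simp add: conj_by_def T.m_assoc)
qed

end

section \<open>Realizing an exterior pairing over a free group\<close>

text \<open>Four cancellation rules that carry relations of the form \<open>t x = x u\<close> and \<open>x y = y x t\<close> to
  inverses and products of \<open>x\<close>.\<close>

lemma (in group) conj_relation_inv:
  assumes "x \<in> carrier G" "t \<in> carrier G" "u \<in> carrier G" "t \<otimes> x = x \<otimes> u"
  shows "u \<otimes> inv x = inv x \<otimes> t"
proof -
  have "inv x \<otimes> t = inv x \<otimes> (t \<otimes> x) \<otimes> inv x" using assms(1-3) by (simp add: m_assoc)
  also have "\<dots> = u \<otimes> inv x" using assms by (simp add: m_assoc)
  finally show ?thesis by simp
qed

lemma (in group) conj_relation_mult:
  assumes "x \<in> carrier G" "y \<in> carrier G" "t \<in> carrier G" "u \<in> carrier G" "v \<in> carrier G"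
    and "t \<otimes> x = x \<otimes> u" "u \<otimes> y = y \<otimes> v"
  shows "t \<otimes> (x \<otimes> y) = x \<otimes> y \<otimes> v"
  using assms by (metis m_assoc)

lemma (in group) commutator_relation_inv:
  assumes "x \<in> carrier G" "y \<in> carrier G" "t \<in> carrier G" "v \<in> carrier G"
    and "x \<otimes> y = y \<otimes> x \<otimes> t" "inv t \<otimes> inv x = inv x \<otimes> v"
  shows "inv x \<otimes> y = y \<otimes> inv x \<otimes> v"
proof -
  have "inv x \<otimes> y = inv x \<otimes> (y \<otimes> x \<otimes> t) \<otimes> inv t \<otimes> inv x"
    using assms(1-4) by (simp add: m_assoc)
  also have "\<dots> = y \<otimes> (inv t \<otimes> inv x)"
    unfolding assms(5)[symmetric] using assms(1-4) by (simp add: m_assoc)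
  finally show ?thesis using assms by (simp add: m_assoc)
qed

lemma (in group) commutator_relation_mult:
  assumes "x \<in> carrier G" "y \<in> carrier G" "z \<in> carrier G"
    and "t \<in> carrier G" "u \<in> carrier G" "v \<in> carrier G"
    and "x \<otimes> y = y \<otimes> x \<otimes> t" "z \<otimes> y = y \<otimes> z \<otimes> u" "t \<otimes> z = z \<otimes> v"
  shows "x \<otimes> z \<otimes> y = y \<otimes> (x \<otimes> z) \<otimes> (v \<otimes> u)"
proof -
  have "x \<otimes> z \<otimes> y = (x \<otimes> y) \<otimes> z \<otimes> u" using assms(1-6,8) by (simp add: m_assoc)
  also have "\<dots> = y \<otimes> x \<otimes> (t \<otimes> z) \<otimes> u" using assms(1-7) by (simp add: m_assoc)
  finally show ?thesis using assms by (simp add: m_assoc)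
qed

text \<open>Products are read from left to right, so that the group acts on the right.\<close>

definition perm_group :: "('s \<Rightarrow> 's) monoid" where
  "perm_group = \<lparr>carrier = {f. bij f}, mult = (\<lambda>f g. g \<circ> f), one = id\<rparr>"

lemma perm_group_simps:
  "carrier perm_group = {f. bij f}" "f \<otimes>\<^bsub>perm_group\<^esub> g = g \<circ> f" "\<one>\<^bsub>perm_group\<^esub> = id"
  by (simp_all add: perm_group_def)

lemma group_perm_group: "group perm_group"
proof (rule groupI)
  fix f :: "'s \<Rightarrow> 's" assume "f \<in> carrier perm_group"
  then show "\<exists>g\<in>carrier perm_group. g \<otimes>\<^bsub>perm_group\<^esub> f = \<one>\<^bsub>perm_group\<^esub>"
    by (intro bexI[of _ "inv_into UNIV f"])
      (simp_all add: perm_group_simps bij_imp_bij_inv bij_is_surj flip: surj_iff)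
qed (auto simp: perm_group_simps bij_comp comp_assoc)

lemma pc_word_split:
  assumes "group H" "\<And>k. \<lbrakk>1 \<le> k; k \<le> n\<rbrakk> \<Longrightarrow> g k \<in> carrier H" "i < j" "j \<le> n"
  shows "pc_word H g i n a = list_mult H (map (\<lambda>k. g k [^]\<^bsub>H\<^esub> a k) [Suc i..<j]) \<otimes>\<^bsub>H\<^esub>
    (g j [^]\<^bsub>H\<^esub> a j \<otimes>\<^bsub>H\<^esub> pc_word H g j n a)"
proof -
  interpret group H by (rule assms(1))
  have split: "[Suc i..<Suc n] = [Suc i..<j] @ j # [Suc j..<Suc n]"
    using upt_add_eq_append[of "Suc i" j "Suc n - j"] assms(3,4)
    by (simp add: upt_conv_Cons del: upt_Suc)
  show ?thesis
    unfolding pc_word_def split map_append list.map using assms(2-4)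
    by (subst list_mult_append) auto
qed

text \<open>The free group is a parameter \<open>F\<close> with a defining equation, to keep rewriting of the interval
  \<open>{1..n}\<close> out of statements about \<open>F\<close>.\<close>

locale free_exterior_pairing = equivariant_exterior_pairing G T w q hatv act +
  \<pi>: group_hom F G \<pi>
  for G (structure) and T (structure) and w q hatv act and n :: nat and F and \<pi> +
  assumes F_eq: "F = free_group {1..n}"
begin

abbreviation "g j \<equiv> \<pi> (free_gen j)"
abbreviation "tail a j \<equiv> pc_word G g j n a"

abbreviation M :: "((nat \<Rightarrow> int) \<times> 'c \<Rightarrow> (nat \<Rightarrow> int) \<times> 'c) monoid" where
  "M \<equiv> perm_group"

text \<open>The pair \<open>(a, t)\<close> stands for \<open>g\<^sub>1\<^bsup>a 1\<^esup> \<cdots> g\<^sub>n\<^bsup>a n\<^esup> t\<close>. Writing \<open>v\<close> for \<open>tail a j\<close>, right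
  multiplication by \<open>g\<^sub>j\<close> is suggested by \<open>v t g\<^sub>j = g\<^sub>j v [v, g\<^sub>j] t\<^bsup>g j\<^esup>\<close>, with \<open>v \<and> g\<^sub>j\<close> taking the place of
  the commutator. Pairs with \<open>t\<close> outside \<open>W\<close> are fixed; this makes the permutations total.\<close>

definition step :: "nat \<Rightarrow> (nat \<Rightarrow> int) \<times> 'c \<Rightarrow> (nat \<Rightarrow> int) \<times> 'c" where
  "step j = (\<lambda>(a, t). if t \<in> W
     then (a(j := a j + 1), w (tail a j) (g j) \<otimes>\<^bsub>T\<^esub> act (g j) t) else (a, t))"

definition shift :: "'c \<Rightarrow> (nat \<Rightarrow> int) \<times> 'c \<Rightarrow> (nat \<Rightarrow> int) \<times> 'c" where
  "shift u = (\<lambda>(a, t). if t \<in> W then (a, t \<otimes>\<^bsub>T\<^esub> u) else (a, t))"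

definition realize :: "nat word \<Rightarrow> (nat \<Rightarrow> int) \<times> 'c \<Rightarrow> (nat \<Rightarrow> int) \<times> 'c" where
  "realize = word_value M step"

sublocale M: group M
  by (rule group_perm_group)

lemma gen_closed [simp]: "j \<in> {1..n} \<Longrightarrow> free_gen j \<in> carrier F"
  by (simp add: F_eq)

lemma g_closed: "j \<in> {1..n} \<Longrightarrow> g j \<in> carrier G"
  by simp

lemma F_subgroup_induct:
  assumes "subgroup K F" "\<And>j. j \<in> {1..n} \<Longrightarrow> free_gen j \<in> K" "x \<in> carrier F"
  shows "x \<in> K"
  using assms unfolding F_eq by (rule free_group_subgroup_induct)

lemma tail_closed [simp]: "tail a j \<in> carrier G"
  unfolding pc_word_def by (rule list_mult_closed) auto

lemma tail_update [simp]: "i \<le> j \<Longrightarrow> tail (a(i := b)) j = tail a j"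
  unfolding pc_word_def by (intro arg_cong[where f = "list_mult G"] map_cong) auto

text \<open>Inserting \<open>g\<^sub>j\<close> at its place in the middle of \<open>tail a i\<close> differs from appending it by the
  commutator with what follows.\<close>

lemma tail_step:
  assumes "i < j" "j \<in> {1..n}"
  shows "tail (a(j := a j + 1)) i = tail a i \<otimes> g j \<otimes> commutator G (g j) (tail a j)"
proof -
  let ?b = "a(j := a j + 1)"
  have split: "tail c i = list_mult G (map (\<lambda>k. g k [^] c k) [Suc i..<j]) \<otimes>
    (g j [^] c j \<otimes> tail c j)" for c
    using assms by (intro pc_word_split[OF is_group]) auto
  have m: "map (\<lambda>k. g k [^] ?b k) [Suc i..<j] = map (\<lambda>k. g k [^] a k) [Suc i..<j]" by simp
  have "tail ?b i = list_mult G (map (\<lambda>k. g k [^] a k) [Suc i..<j]) \<otimes>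
      (g j [^] (a j + 1) \<otimes> tail a j)"
    using split[of ?b] by (simp only: m fun_upd_same tail_update order.refl)
  moreover have "list_mult G (map (\<lambda>k. g k [^] a k) [Suc i..<j]) \<in> carrier G"
    using assms by (intro list_mult_closed) auto
  moreover have "g j [^] (a j + 1) = g j [^] a j \<otimes> g j"
    using assms by (simp add: int_pow_mult)
  ultimately show ?thesis
    using assms unfolding split[of a] by (simp add: commutator_def m_assoc del: fun_upd_apply)
qed

lemma step_perm:
  assumes "j \<in> {1..n}"
  shows "step j \<in> carrier M"
proof -
  \<comment> \<open>\<open>tail a j\<close> does not involve \<open>a j\<close>, so it is the same before and after the step\<close>
  define unstep where "unstep = (\<lambda>(a :: nat \<Rightarrow> int, t). if t \<in> W
     then (a(j := a j - 1), act (inv g j) (inv\<^bsub>T\<^esub> w (tail a j) (g j) \<otimes>\<^bsub>T\<^esub> t)) else (a, t))"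
  have "unstep \<circ> step j = id"
    using assms by (auto simp: unstep_def step_def fun_eq_iff act_act act_one simp del: act_mult)
  moreover have "step j \<circ> unstep = id"
    using assms by (auto simp: unstep_def step_def fun_eq_iff act_act act_one simp del: act_mult)
  ultimately show ?thesis by (simp add: perm_group_simps o_bij)
qed

lemma shift_mult:
  assumes "u \<in> W" "v \<in> W"
  shows "shift (u \<otimes>\<^bsub>T\<^esub> v) = shift u \<otimes>\<^bsub>M\<^esub> shift v"
  using assms by (auto simp: perm_group_simps shift_def fun_eq_iff T.m_assoc)

lemma shift_one [simp]: "shift \<one>\<^bsub>T\<^esub> = \<one>\<^bsub>M\<^esub>"
  by (auto simp: perm_group_simps shift_def fun_eq_iff)

lemma shift_perm [simp]:
  assumes "u \<in> W"
  shows "shift u \<in> carrier M"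
proof -
  have *: "shift (inv\<^bsub>T\<^esub> v) \<circ> shift v = id" if "v \<in> W" for v
    using shift_mult[of v "inv\<^bsub>T\<^esub> v"] that by (simp add: perm_group_simps)
  have "shift u \<circ> shift (inv\<^bsub>T\<^esub> u) = id" using *[of "inv\<^bsub>T\<^esub> u"] assms by simp
  from o_bij[OF *[OF assms] this] show ?thesis by (simp add: perm_group_simps)
qed

lemma shift_inv:
  assumes "u \<in> W"
  shows "shift (inv\<^bsub>T\<^esub> u) = inv\<^bsub>M\<^esub> shift u"
  using shift_mult[of "inv\<^bsub>T\<^esub> u" u] assms by (intro M.inv_equality[symmetric]) simp_all

lemma shift_pow:
  assumes "u \<in> W"
  shows "shift (u [^]\<^bsub>T\<^esub> (m :: nat)) = shift u [^]\<^bsub>M\<^esub> m"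
proof (induction m)
  case (Suc m)
  have "u [^]\<^bsub>T\<^esub> m \<in> W" using assms by (induction m) auto
  with Suc assms show ?case by (simp only: T.nat_pow_Suc M.nat_pow_Suc shift_mult)
qed simp

lemma list_mult_in_W: "set us \<subseteq> W \<Longrightarrow> list_mult T us \<in> W"
  by (induction us) auto

lemma shift_list_mult: "set us \<subseteq> W \<Longrightarrow> shift (list_mult T us) = list_mult M (map shift us)"
  by (induction us) (simp_all add: shift_mult list_mult_in_W)

lemma shift_eq_one:
  assumes "shift u = \<one>\<^bsub>M\<^esub>" "u \<in> carrier T"
  shows "u = \<one>\<^bsub>T\<^esub>"
  using fun_cong[OF assms(1), of "(\<lambda>_. 0, \<one>\<^bsub>T\<^esub>)"] assms(2) by (simp add: perm_group_simps shift_def)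

lemma shift_step:
  assumes "j \<in> {1..n}" "t \<in> W"
  shows "shift t \<otimes>\<^bsub>M\<^esub> step j = step j \<otimes>\<^bsub>M\<^esub> shift (act (g j) t)"
  using assms by (auto simp: perm_group_simps shift_def step_def fun_eq_iff T.m_assoc)

text \<open>The one computation on which the action rests. Put \<open>V = v\<^sub>j \<and> g\<^sub>j\<close> and \<open>X = v\<^sub>i g\<^sub>j \<and> g\<^sub>i\<close>, where
  \<open>v\<^sub>i = tail a i\<close> and \<open>v\<^sub>j = tail a j\<close>. If \<open>g\<^sub>j\<close> acts first, then \<open>v\<^sub>i\<close> becomes \<open>v\<^sub>i g\<^sub>j c\<close> with
  \<open>c = [g\<^sub>j, v\<^sub>j]\<close>, and \<open>v\<^sub>i g\<^sub>j c \<and> g\<^sub>i = X\<^sup>c (c \<and> g\<^sub>i)\<close>. The first factor is \<open>V X V\<^sup>-\<^sup>1\<close> by the crossed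
  identity, the second one is \<open>V\<close> times the inverse of \<open>V\<close> conjugated by \<open>g\<^sub>i\<close>; the extra factor
  cancels against the term coming from the action of \<open>g\<^sub>i\<close>.\<close>

lemma step_step:
  assumes "i < j" "i \<in> {1..n}" "j \<in> {1..n}"
  shows "step i \<otimes>\<^bsub>M\<^esub> step j = step j \<otimes>\<^bsub>M\<^esub> step i \<otimes>\<^bsub>M\<^esub> shift (w (g i) (g j))"
proof -
  have "w (tail a j) (g j) \<otimes>\<^bsub>T\<^esub> act (g j) (w (tail a i) (g i) \<otimes>\<^bsub>T\<^esub> act (g i) t) =
      w (tail (a(j := a j + 1)) i) (g i) \<otimes>\<^bsub>T\<^esub>
        act (g i) (w (tail a j) (g j) \<otimes>\<^bsub>T\<^esub> act (g j) t) \<otimes>\<^bsub>T\<^esub> w (g i) (g j)"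
    if t: "t \<in> W" for a t
  proof -
    note g [simp] = g_closed[OF assms(2)] g_closed[OF assms(3)]
    let ?c = "commutator G (g j) (tail a j)" and ?V = "w (tail a j) (g j)"
      and ?X = "w (tail a i \<otimes> g j) (g i)"
    have X: "?X = act (g j) (w (tail a i) (g i)) \<otimes>\<^bsub>T\<^esub> w (g j) (g i)"
      by (simp add: w_mult_left act_w)
    have "act ?c ?X = conj_by T ?X (w (g j) (tail a j))"
      by (simp add: act_w conj_by_w)
    also have "\<dots> = ?V \<otimes>\<^bsub>T\<^esub> ?X \<otimes>\<^bsub>T\<^esub> inv\<^bsub>T\<^esub> ?V"
      using w_swap[of "tail a j" "g j"] by (simp add: conj_by_def)
    finally have c: "act ?c ?X = ?V \<otimes>\<^bsub>T\<^esub> ?X \<otimes>\<^bsub>T\<^esub> inv\<^bsub>T\<^esub> ?V" .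
    have "w ?c (g i) = ?V \<otimes>\<^bsub>T\<^esub> inv\<^bsub>T\<^esub> act (g i) ?V"
      using w_swap[of "tail a j" "g j"] by (simp add: w_commutator)
    then have "w (tail (a(j := a j + 1)) i) (g i) = ?V \<otimes>\<^bsub>T\<^esub> ?X \<otimes>\<^bsub>T\<^esub> inv\<^bsub>T\<^esub> act (g i) ?V"
      unfolding tail_step[OF assms(1,3)] using c
      by (simp add: w_mult_left[of "tail a i \<otimes> g j"] T.m_assoc flip: act_w)
    then have "w (tail (a(j := a j + 1)) i) (g i) \<otimes>\<^bsub>T\<^esub>
        act (g i) (?V \<otimes>\<^bsub>T\<^esub> act (g j) t) \<otimes>\<^bsub>T\<^esub> w (g i) (g j) =
      ?V \<otimes>\<^bsub>T\<^esub> (?X \<otimes>\<^bsub>T\<^esub> (act (g j \<otimes> g i) t \<otimes>\<^bsub>T\<^esub> w (g i) (g j)))"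
      using t by (simp add: T.m_assoc act_act)
    also have "act (g j \<otimes> g i) t \<otimes>\<^bsub>T\<^esub> w (g i) (g j) = w (g i) (g j) \<otimes>\<^bsub>T\<^esub> act (g i \<otimes> g j) t"
      using t by (simp add: crossed_W)
    also have "?V \<otimes>\<^bsub>T\<^esub> (?X \<otimes>\<^bsub>T\<^esub> (w (g i) (g j) \<otimes>\<^bsub>T\<^esub> act (g i \<otimes> g j) t)) =
      ?V \<otimes>\<^bsub>T\<^esub> act (g j) (w (tail a i) (g i) \<otimes>\<^bsub>T\<^esub> act (g i) t)"
      unfolding X using t w_swap[of "g i" "g j"] by (simp add: T.m_assoc act_act)
    finally show ?thesis by (rule sym)
  qed
  then show ?thesis
    using assms by (auto simp: perm_group_simps shift_def step_def fun_eq_iff fun_upd_twist)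
qed

sublocale realize: group_hom F M realize
  unfolding realize_def F_eq by (rule M.word_value_hom) (rule step_perm)

lemma realize_gen [simp]: "j \<in> {1..n} \<Longrightarrow> realize (free_gen j) = step j"
  unfolding realize_def using step_perm by (intro M.word_value_gen) auto

text \<open>It suffices to treat generators, where it is \<open>shift_step\<close>.\<close>

lemma shift_realize:
  assumes x: "x \<in> carrier F" and t: "t \<in> W"
  shows "shift t \<otimes>\<^bsub>M\<^esub> realize x = realize x \<otimes>\<^bsub>M\<^esub> shift (act (\<pi> x) t)"
proof -
  let ?K = "{x \<in> carrier F. \<forall>t\<in>W. shift t \<otimes>\<^bsub>M\<^esub> realize x = realize x \<otimes>\<^bsub>M\<^esub> shift (act (\<pi> x) t)}"
  have "subgroup ?K F"
  proof (rule \<pi>.G.subgroupI)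
    fix x assume x: "x \<in> ?K"
    have "shift t \<otimes>\<^bsub>M\<^esub> inv\<^bsub>M\<^esub> realize x = inv\<^bsub>M\<^esub> realize x \<otimes>\<^bsub>M\<^esub> shift (act (inv \<pi> x) t)"
      if t: "t \<in> W" for t
      using x t by (intro M.conj_relation_inv) (auto simp: act_act act_one)
    then show "inv\<^bsub>F\<^esub> x \<in> ?K" using x by simp
  next
    fix x y assume x: "x \<in> ?K" and y: "y \<in> ?K"
    have "shift t \<otimes>\<^bsub>M\<^esub> (realize x \<otimes>\<^bsub>M\<^esub> realize y) =
        realize x \<otimes>\<^bsub>M\<^esub> realize y \<otimes>\<^bsub>M\<^esub> shift (act (\<pi> y) (act (\<pi> x) t))"
      if t: "t \<in> W" for t
      using x y t by (intro M.conj_relation_mult[of _ _ _ "shift (act (\<pi> x) t)"]) auto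
    then show "x \<otimes>\<^bsub>F\<^esub> y \<in> ?K" using x y by (simp add: act_act)
  qed (use act_one in \<open>auto intro!: exI[of _ "\<one>\<^bsub>F\<^esub>"]\<close>)
  moreover have "free_gen j \<in> ?K" if "j \<in> {1..n}" for j
    using that shift_step by simp
  ultimately have "x \<in> ?K" using x by (rule F_subgroup_induct)
  with t show ?thesis by blast
qed

lemma realize_swap:
  assumes x: "x \<in> carrier F" and y: "y \<in> carrier F"
    and xy: "realize x \<otimes>\<^bsub>M\<^esub> realize y = realize y \<otimes>\<^bsub>M\<^esub> realize x \<otimes>\<^bsub>M\<^esub> shift (w (\<pi> x) (\<pi> y))"
  shows "realize y \<otimes>\<^bsub>M\<^esub> realize x = realize x \<otimes>\<^bsub>M\<^esub> realize y \<otimes>\<^bsub>M\<^esub> shift (w (\<pi> y) (\<pi> x))"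
proof -
  have "w (\<pi> y) (\<pi> x) = inv\<^bsub>T\<^esub> w (\<pi> x) (\<pi> y)" using x y by (intro w_swap) auto
  then have "shift (w (\<pi> y) (\<pi> x)) = inv\<^bsub>M\<^esub> shift (w (\<pi> x) (\<pi> y))"
    using x y by (simp add: shift_inv)
  then show ?thesis unfolding xy using x y by (simp add: M.m_assoc)
qed

text \<open>The set of \<open>x\<close> for which the commutator of \<open>x\<close> and a fixed \<open>y\<close> is realized correctly is a
  subgroup, because \<open>w\<close> and the commutator expand in the same way in the first argument.\<close>

lemma subgroup_realize_mult:
  assumes y: "y \<in> carrier F"
  shows "subgroup {x \<in> carrier F. realize x \<otimes>\<^bsub>M\<^esub> realize y =
    realize y \<otimes>\<^bsub>M\<^esub> realize x \<otimes>\<^bsub>M\<^esub> shift (w (\<pi> x) (\<pi> y))} F" (is "subgroup ?K F")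
proof (rule \<pi>.G.subgroupI)
  fix x assume x: "x \<in> ?K"
  let ?t = "w (\<pi> x) (\<pi> y)"
  have "shift (inv\<^bsub>T\<^esub> ?t) \<otimes>\<^bsub>M\<^esub> realize (inv\<^bsub>F\<^esub> x) =
      realize (inv\<^bsub>F\<^esub> x) \<otimes>\<^bsub>M\<^esub> shift (act (\<pi> (inv\<^bsub>F\<^esub> x)) (inv\<^bsub>T\<^esub> ?t))"
    using x y by (intro shift_realize) auto
  then have "inv\<^bsub>M\<^esub> realize x \<otimes>\<^bsub>M\<^esub> realize y =
      realize y \<otimes>\<^bsub>M\<^esub> inv\<^bsub>M\<^esub> realize x \<otimes>\<^bsub>M\<^esub> shift (act (inv \<pi> x) (inv\<^bsub>T\<^esub> ?t))"
    using x y by (intro M.commutator_relation_inv[of _ _ "shift ?t"]) (auto simp: shift_inv)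
  then show "inv\<^bsub>F\<^esub> x \<in> ?K"
    using x y by (simp add: w_inv_left)
next
  fix x z assume x: "x \<in> ?K" and z: "z \<in> ?K"
  let ?t = "w (\<pi> x) (\<pi> y)" and ?u = "w (\<pi> z) (\<pi> y)"
  have "shift ?t \<otimes>\<^bsub>M\<^esub> realize z = realize z \<otimes>\<^bsub>M\<^esub> shift (act (\<pi> z) ?t)"
    using x y z by (intro shift_realize) auto
  then have "realize x \<otimes>\<^bsub>M\<^esub> realize z \<otimes>\<^bsub>M\<^esub> realize y =
      realize y \<otimes>\<^bsub>M\<^esub> (realize x \<otimes>\<^bsub>M\<^esub> realize z) \<otimes>\<^bsub>M\<^esub> (shift (act (\<pi> z) ?t) \<otimes>\<^bsub>M\<^esub> shift ?u)"
    using x y z by (intro M.commutator_relation_mult[of _ _ _ "shift ?t"]) auto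
  then show "x \<otimes>\<^bsub>F\<^esub> z \<in> ?K"
    using x y z by (simp add: w_mult_left shift_mult act_w)
qed (use y in \<open>auto intro!: exI[of _ "\<one>\<^bsub>F\<^esub>"]\<close>)

text \<open>Reduction to generators in both arguments: \<open>subgroup_realize_mult\<close> extends the claim in the
  first argument, and \<open>realize_swap\<close> exchanges the arguments.\<close>

lemma realize_mult_comm:
  assumes x: "x \<in> carrier F" and y: "y \<in> carrier F"
  shows "realize x \<otimes>\<^bsub>M\<^esub> realize y = realize y \<otimes>\<^bsub>M\<^esub> realize x \<otimes>\<^bsub>M\<^esub> shift (w (\<pi> x) (\<pi> y))"
    (is "?C x y")
proof -
  have ind: "?C x y" if "\<And>i. i \<in> {1..n} \<Longrightarrow> ?C (free_gen i) y" "x \<in> carrier F" "y \<in> carrier F" for x y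
    using F_subgroup_induct[OF subgroup_realize_mult[OF that(3)] _ that(2)] that(1) by simp
  have "?C (free_gen i) (free_gen j)" if ij: "i \<in> {1..n}" "j \<in> {1..n}" for i j
  proof -
    have less: "?C (free_gen i) (free_gen j)" if "i < j" "i \<in> {1..n}" "j \<in> {1..n}" for i j
      using step_step that by simp
    consider "i < j" | "i = j" | "j < i" by linarith
    then show ?thesis
    proof cases
      case 2
      then show ?thesis using ij step_perm by simp
    next
      case 3
      then show ?thesis using ij by (intro realize_swap[OF _ _ less]) auto
    qed (use less ij in auto)
  qed
  then have "?C x (free_gen j)" if "x \<in> carrier F" "j \<in> {1..n}" for x j
    by (rule ind) (use that in auto)
  then have "?C (free_gen j) x" if "x \<in> carrier F" "j \<in> {1..n}" for x j
    by (rule realize_swap[rotated 2]) (use that in auto)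
  then show ?thesis by (rule ind) (use x y in auto)
qed

lemma realize_commutator:
  assumes x: "x \<in> carrier F" and y: "y \<in> carrier F"
  shows "realize (commutator F x y) = shift (w (\<pi> x) (\<pi> y))"
    and "commutator M (realize x) (realize y) = shift (w (\<pi> x) (\<pi> y))"
proof -
  have "commutator M (realize x) (realize y) =
      inv\<^bsub>M\<^esub> realize x \<otimes>\<^bsub>M\<^esub> (inv\<^bsub>M\<^esub> realize y \<otimes>\<^bsub>M\<^esub> (realize x \<otimes>\<^bsub>M\<^esub> realize y))"
    using x y by (simp add: commutator_def M.m_assoc)
  also have "\<dots> = shift (w (\<pi> x) (\<pi> y))"
    unfolding realize_mult_comm[OF x y] using x y by (simp add: M.m_assoc)
  finally show "commutator M (realize x) (realize y) = shift (w (\<pi> x) (\<pi> y))" .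
  then show "realize (commutator F x y) = shift (w (\<pi> x) (\<pi> y))"
    using x y by (simp add: realize.hom_commutator)
qed

lemma conj_by_shift_realize:
  assumes "x \<in> carrier F" "t \<in> W"
  shows "conj_by M (shift t) (realize x) = shift (act (\<pi> x) t)"
proof -
  show ?thesis using assms by (simp add: conj_by_def M.m_assoc shift_realize)
qed

end

section \<open>Exponent sums\<close>

definition exponent_sum :: "'a \<Rightarrow> 'a word \<Rightarrow> int" where
  "exponent_sum a = word_value integer_group (\<lambda>b. if b = a then 1 else 0)"

lemma exponent_sum_hom: "group_hom (free_group S) integer_group (exponent_sum a)"
  unfolding exponent_sum_def by (rule group.word_value_hom) auto

lemma exponent_sum_gen [simp]: "exponent_sum a (free_gen b) = (if b = a then 1 else 0)"
  unfolding exponent_sum_def by (subst group.word_value_gen) auto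

lemma exponent_sum_commutator:
  assumes "x \<in> carrier (free_group S)" "y \<in> carrier (free_group S)"
  shows "exponent_sum a (commutator (free_group S) x y) = 0"
proof -
  interpret group_hom "free_group S" integer_group "exponent_sum a" by (rule exponent_sum_hom)
  show ?thesis using assms by (simp add: hom_commutator) (simp add: commutator_def)
qed

text \<open>In the abelianization the image of \<open>x\<close> is the product of the powers of the images of the
  generators by the exponent sums of \<open>x\<close>, because both sides are homomorphisms in \<open>x\<close>.\<close>

lemma exponent_sum_zero_imp_derived:
  assumes S: "finite S" and x: "x \<in> carrier (free_group S)"
    and zero: "\<And>a. a \<in> S \<Longrightarrow> exponent_sum a x = 0"
  shows "x \<in> derived (free_group S) (carrier (free_group S))"
proof -
  interpret F: group "free_group S" by (rule group_free_group)
  let ?D = "derived (free_group S) (carrier (free_group S))"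
  interpret D: normal ?D "free_group S" by (rule F.derived_self_is_normal)
  let ?A = "free_group S Mod ?D" and ?d = "\<lambda>x. ?D #>\<^bsub>free_group S\<^esub> x"
  interpret A: comm_group ?A by (rule F.derived_quot_is_comm_group)
  interpret d: group_hom "free_group S" ?A ?d by (rule D.coset_hom)
  let ?f = "\<lambda>x. finprod ?A (\<lambda>a. ?d (free_gen a) [^]\<^bsub>?A\<^esub> exponent_sum a x) S"
  have gen: "?d (free_gen a) \<in> carrier ?A" if "a \<in> S" for a
    using that by (intro d.hom_closed) auto
  have "?f (x \<otimes>\<^bsub>free_group S\<^esub> y) = ?f x \<otimes>\<^bsub>?A\<^esub> ?f y"
    if "x \<in> carrier (free_group S)" "y \<in> carrier (free_group S)" for x y
  proof -
    have "exponent_sum a (x \<otimes>\<^bsub>free_group S\<^esub> y) = exponent_sum a x + exponent_sum a y" for a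
      using group_hom.hom_mult[OF exponent_sum_hom that] by simp
    then have "?f (x \<otimes>\<^bsub>free_group S\<^esub> y) = finprod ?A (\<lambda>a.
        ?d (free_gen a) [^]\<^bsub>?A\<^esub> exponent_sum a x \<otimes>\<^bsub>?A\<^esub> ?d (free_gen a) [^]\<^bsub>?A\<^esub> exponent_sum a y) S"
      using gen by (intro A.finprod_cong') (auto simp only: A.int_pow_mult intro!: A.m_closed A.int_pow_closed)
    also have "\<dots> = ?f x \<otimes>\<^bsub>?A\<^esub> ?f y"
      using gen by (intro A.finprod_multf) (auto intro!: A.int_pow_closed)
    finally show ?thesis .
  qed
  then have "?f \<in> hom (free_group S) ?A"
    using gen by (intro homI) (auto intro!: A.finprod_closed A.int_pow_closed)
  then have f: "group_hom (free_group S) ?A ?f"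
    by (intro group_hom.intro group_hom_axioms.intro F.is_group A.is_group)
  have "?d (free_gen b) = ?f (free_gen b)" if b: "b \<in> S" for b
  proof -
    have "?f (free_gen b) = finprod ?A (\<lambda>a. if b = a then ?d (free_gen a) else \<one>\<^bsub>?A\<^esub>) S"
      using gen A.one_closed by (intro A.finprod_cong') auto
    also have "\<dots> = ?d (free_gen b)"
      using gen b S by (intro A.finprod_singleton) auto
    finally show ?thesis by simp
  qed
  from free_group_hom_eqI[OF d.group_hom_axioms f this x] have "?d x = ?f x" .
  also have "\<dots> = \<one>\<^bsub>?A\<^esub>"
    using zero by (intro A.finprod_one_eqI) simp
  finally have "x \<in> kernel (free_group S) ?A ?d" using x by (simp add: kernel_def)
  then show ?thesis by (simp add: D.coset_kernel)
qed

section \<open>Central elements of the cover have trivial wedge products\<close>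

context free_exterior_pairing
begin

lemma hat_expansion_in_W:
  assumes "k \<in> carrier G" "k1 \<in> carrier G"
  shows "hat_expansion q G T w k k1 \<in> W"
  unfolding hat_expansion_def using assms by (intro list_mult_in_W) auto

text \<open>The expansion of \<open>(x y)\<^sup>q\<close> consists of conjugates of commutators, which are realized by the
  factors of \<open>hat_expansion\<close>.\<close>

lemma realize_power_mult:
  assumes x: "x \<in> carrier F" and y: "y \<in> carrier F"
  shows "realize (x \<otimes>\<^bsub>F\<^esub> y) [^]\<^bsub>M\<^esub> q =
    realize x [^]\<^bsub>M\<^esub> q \<otimes>\<^bsub>M\<^esub> shift (hat_expansion q G T w (\<pi> x) (\<pi> y)) \<otimes>\<^bsub>M\<^esub> realize y [^]\<^bsub>M\<^esub> q"
proof -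
  have "conj_by M (commutator M (realize x) (inv\<^bsub>M\<^esub> realize y [^]\<^bsub>M\<^esub> i)) (realize x [^]\<^bsub>M\<^esub> k) =
      shift (w (conj_by G (\<pi> x) (\<pi> x [^] k)) (conj_by G (inv \<pi> y [^] i) (\<pi> x [^] k)))" for i k :: nat
  proof -
    have "conj_by M (commutator M (realize x) (realize (inv\<^bsub>F\<^esub> y [^]\<^bsub>F\<^esub> i))) (realize (x [^]\<^bsub>F\<^esub> k)) =
        shift (act (\<pi> (x [^]\<^bsub>F\<^esub> k)) (w (\<pi> x) (\<pi> (inv\<^bsub>F\<^esub> y [^]\<^bsub>F\<^esub> i))))"
      using x y by (subst realize_commutator(2)) (auto intro!: conj_by_shift_realize)
    then show ?thesis using x y by (simp add: act_w realize.hom_nat_pow \<pi>.hom_nat_pow)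
  qed
  moreover have "set (map (\<lambda>i. w (conj_by G (\<pi> x) (\<pi> x [^] (q - 1 - i)))
      (conj_by G (inv \<pi> y [^] i) (\<pi> x [^] (q - 1 - i)))) [1..<q]) \<subseteq> W"
    using x y by auto
  ultimately show ?thesis
    using M.power_mult_expand[of "realize x" "realize y" q] x y
    by (simp add: hat_expansion_def shift_list_mult comp_def del: diff_diff_left diff_Suc_eq_diff_pred)
qed

lemma realize_kernel_comm:
  assumes "r \<in> carrier F" "\<pi> r = \<one>" "x \<in> carrier F"
  shows "realize r \<otimes>\<^bsub>M\<^esub> realize x = realize x \<otimes>\<^bsub>M\<^esub> realize r"
  using realize_mult_comm[of r x] assms by simp

text \<open>The elements \<open>x\<close> for which \<open>x\<^sup>q\<close> acts as multiplication by the hat of \<open>\<pi> x\<close>, and that hat lies in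
  \<open>W\<close>, form a subgroup by the relation for the hat of a product; it contains all commutators by the
  relation for the hat of a commutator.\<close>

lemma realize_power_derived:
  assumes q: "0 < q" and x: "x \<in> derived F (carrier F)"
  shows "realize x [^]\<^bsub>M\<^esub> q = shift (hatv (\<pi> x))"
proof -
  let ?Z = "{x \<in> carrier F. hatv (\<pi> x) \<in> W \<and> realize x [^]\<^bsub>M\<^esub> q = shift (hatv (\<pi> x))}"
  have hat_mult: "hatv (k \<otimes> k1) = hatv k \<otimes>\<^bsub>T\<^esub> hat_expansion q G T w k k1 \<otimes>\<^bsub>T\<^esub> hatv k1"
    if "k \<in> carrier G" "k1 \<in> carrier G" for k k1
    using hat_relations[OF q] that by (simp add: hat_relations_def)
  have hat_comm: "hatv (commutator G k k1) = w k k1 [^]\<^bsub>T\<^esub> q"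
    if "k \<in> carrier G" "k1 \<in> carrier G" for k k1
    using hat_relations[OF q] that by (simp add: hat_relations_def)
  have comm: "commutator F x y \<in> ?Z" if "x \<in> carrier F" "y \<in> carrier F" for x y
  proof -
    have "w (\<pi> x) (\<pi> y) [^]\<^bsub>T\<^esub> m \<in> W" for m :: nat using that by (induction m) auto
    then show ?thesis
      using that by (simp add: realize_commutator \<pi>.hom_commutator hat_comm shift_pow)
  qed
  have one: "hatv \<one> = \<one>\<^bsub>T\<^esub>"
    using hat_comm[of \<one> \<one>] by (simp add: commutator_def)
  have "subgroup ?Z F"
  proof (rule \<pi>.G.subgroupI)
    fix x assume x: "x \<in> ?Z"
    let ?P = "hat_expansion q G T w (\<pi> x) (inv \<pi> x)"
    have P: "?P \<in> W" using x by (intro hat_expansion_in_W) auto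
    have c: "hatv (inv \<pi> x) \<in> carrier T" "hatv (\<pi> x) \<in> W" using x q by (auto intro: hat_closed)
    have "hatv (\<pi> x) \<otimes>\<^bsub>T\<^esub> ?P \<otimes>\<^bsub>T\<^esub> hatv (inv \<pi> x) = \<one>\<^bsub>T\<^esub>"
      using hat_mult[of "\<pi> x" "inv \<pi> x"] x one by simp
    then have h: "hatv (inv \<pi> x) = inv\<^bsub>T\<^esub> (hatv (\<pi> x) \<otimes>\<^bsub>T\<^esub> ?P)"
      using c P by (metis T.inv_equality T.inv_inv T.m_closed W.mem_carrier)
    have "shift (hatv (\<pi> x) \<otimes>\<^bsub>T\<^esub> ?P) \<otimes>\<^bsub>M\<^esub> realize (inv\<^bsub>F\<^esub> x) [^]\<^bsub>M\<^esub> q = \<one>\<^bsub>M\<^esub>"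
      using realize_power_mult[of x "inv\<^bsub>F\<^esub> x"] x P by (simp add: shift_mult)
    then have "realize (inv\<^bsub>F\<^esub> x) [^]\<^bsub>M\<^esub> q = inv\<^bsub>M\<^esub> shift (hatv (\<pi> x) \<otimes>\<^bsub>T\<^esub> ?P)"
      using c P x by (metis (no_types, lifting) M.inv_equality M.inv_inv M.nat_pow_closed W.m_closed
        \<pi>.G.inv_closed mem_Collect_eq realize.hom_closed shift_perm)
    then show "inv\<^bsub>F\<^esub> x \<in> ?Z"
      using x c P h by (simp add: shift_inv)
  next
    fix x y assume x: "x \<in> ?Z" and y: "y \<in> ?Z"
    have "hat_expansion q G T w (\<pi> x) (\<pi> y) \<in> W" using x y by (intro hat_expansion_in_W) auto
    then show "x \<otimes>\<^bsub>F\<^esub> y \<in> ?Z"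
      using x y realize_power_mult[of x y] by (simp add: hat_mult shift_mult)
  next
    show "?Z \<noteq> {}" using comm[of "\<one>\<^bsub>F\<^esub>" "\<one>\<^bsub>F\<^esub>"] by blast
  qed auto
  moreover have "derived_set F (carrier F) \<subseteq> ?Z"
  proof (intro UN_least)
    fix x y assume xy: "x \<in> carrier F" "y \<in> carrier F"
    have "x \<otimes>\<^bsub>F\<^esub> y \<otimes>\<^bsub>F\<^esub> inv\<^bsub>F\<^esub> x \<otimes>\<^bsub>F\<^esub> inv\<^bsub>F\<^esub> y = commutator F (inv\<^bsub>F\<^esub> x) (inv\<^bsub>F\<^esub> y)"
      using xy by (simp add: commutator_def)
    then show "{x \<otimes>\<^bsub>F\<^esub> y \<otimes>\<^bsub>F\<^esub> inv\<^bsub>F\<^esub> x \<otimes>\<^bsub>F\<^esub> inv\<^bsub>F\<^esub> y} \<subseteq> ?Z"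
      using comm[of "inv\<^bsub>F\<^esub> x" "inv\<^bsub>F\<^esub> y"] xy by simp
  qed
  ultimately have "derived F (carrier F) \<subseteq> ?Z"
    unfolding derived_def by (rule \<pi>.G.generate_subgroup_incl[rotated])
  with x show ?thesis by blast
qed

text \<open>Elements of \<open>R\<close> act as pairwise commuting permutations, so a product of \<open>q\<close>-th powers acts as the
  \<open>q\<close>-th power of the product. The exponent sums are recorded to show later that \<open>r\<close> lies in the
  commutator subgroup.\<close>

lemma realize_power_subgroup:
  assumes R: "subgroup R F" and ker: "\<And>r. r \<in> R \<Longrightarrow> \<pi> r = \<one>"
    and u: "u \<in> power_subgroup F q R"
  shows "\<exists>r\<in>R. realize u = realize r [^]\<^bsub>M\<^esub> q \<and> (\<forall>a. exponent_sum a u = int q * exponent_sum a r)"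
proof -
  interpret R: subgroup R F by (rule R)
  interpret e: group_hom F integer_group "exponent_sum a" for a :: nat
    unfolding F_eq by (rule exponent_sum_hom)
  have pow: "exponent_sum a (r [^]\<^bsub>F\<^esub> q) = int q * exponent_sum a r" if "r \<in> R" for a :: nat and r
    using that by (simp add: e.hom_nat_pow)
  from u show ?thesis
    unfolding power_subgroup_def
  proof (induction u rule: generate.induct)
    case one
    have "realize \<one>\<^bsub>F\<^esub> = realize \<one>\<^bsub>F\<^esub> [^]\<^bsub>M\<^esub> q"
      by simp
    moreover have "\<forall>a. exponent_sum a \<one>\<^bsub>F\<^esub> = int q * exponent_sum a \<one>\<^bsub>F\<^esub>"
      using e.hom_one by simp
    ultimately show ?case using R.one_closed by blast
  next
    case (incl h)
    then obtain r where "r \<in> R" "h = r [^]\<^bsub>F\<^esub> q" by blast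
    then show ?case using pow by (auto simp: realize.hom_nat_pow)
  next
    case (inv h)
    then obtain r where r: "r \<in> R" "h = r [^]\<^bsub>F\<^esub> q" by blast
    then have "inv\<^bsub>F\<^esub> h = (inv\<^bsub>F\<^esub> r) [^]\<^bsub>F\<^esub> q" by (simp add: \<pi>.G.nat_pow_inv)
    with r show ?case
      using pow[of "inv\<^bsub>F\<^esub> r"] by (intro bexI[of _ "inv\<^bsub>F\<^esub> r"]) (auto simp: realize.hom_nat_pow)
  next
    case (eng u v)
    then obtain r s where r: "r \<in> R" "realize u = realize r [^]\<^bsub>M\<^esub> q"
        "\<And>a. exponent_sum a u = int q * exponent_sum a r"
      and s: "s \<in> R" "realize v = realize s [^]\<^bsub>M\<^esub> q"
        "\<And>a. exponent_sum a v = int q * exponent_sum a s"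
      by blast
    have "generate F {x [^]\<^bsub>F\<^esub> q | x. x \<in> R} \<subseteq> carrier F"
      by (intro \<pi>.G.generate_incl) auto
    then have uv: "u \<in> carrier F" "v \<in> carrier F" using eng by auto
    have "realize (u \<otimes>\<^bsub>F\<^esub> v) = realize (r \<otimes>\<^bsub>F\<^esub> s) [^]\<^bsub>M\<^esub> q"
      using r s uv M.pow_mult_distrib[OF realize_kernel_comm[OF _ ker], of r s q] by simp
    moreover have "exponent_sum a (u \<otimes>\<^bsub>F\<^esub> v) = int q * exponent_sum a (r \<otimes>\<^bsub>F\<^esub> s)" for a
      using r s uv e.hom_mult[of u v a] e.hom_mult[of r s a] by (simp add: algebra_simps)
    ultimately show ?case using r(1) s(1) R.m_closed by blast
  qed
qed

text \<open>Write \<open>[x, y] = u v\<close> with \<open>u \<in> R\<^sup>q\<close> and \<open>v \<in> [F, R]\<close>. Then \<open>v\<close> acts trivially, and \<open>u\<close> acts as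
  \<open>r\<^sup>q\<close> where \<open>q\<close> times the exponent sums of \<open>r\<close> are those of \<open>[x, y]\<close>, namely zero; so for
  \<open>q > 0\<close> the element \<open>r\<close> lies in \<open>[F, F]\<close> and \<open>realize_power_derived\<close> applies. On the other
  hand \<open>[x, y]\<close> acts as multiplication by the wedge product.\<close>

theorem w_trivial_if_central_in_q_cover:
  assumes R: "subgroup R F" and ker: "\<And>r. r \<in> R \<Longrightarrow> \<pi> r = \<one>"
    and x: "x \<in> carrier F" and y: "y \<in> carrier F"
    and xy: "commutator F x y \<in> q_cover_kernel q F R"
  shows "w (\<pi> x) (\<pi> y) = \<one>\<^bsub>T\<^esub>"
proof -
  interpret R: subgroup R F by (rule R)
  from xy obtain u v where u: "u \<in> power_subgroup F q R"
    and v: "v \<in> commutator_subgroup F (carrier F) R" and uv: "commutator F x y = u \<otimes>\<^bsub>F\<^esub> v"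
    by (auto simp: q_cover_kernel_def set_mult_def)
  have "power_subgroup F q R \<subseteq> carrier F" "commutator_subgroup F (carrier F) R \<subseteq> carrier F"
    unfolding power_subgroup_def commutator_subgroup_def by (rule \<pi>.G.generate_incl; auto)+
  with u v have c: "u \<in> carrier F" "v \<in> carrier F" by auto
  have "commutator_subgroup F (carrier F) R \<subseteq> kernel F M realize"
    unfolding commutator_subgroup_def
    by (rule \<pi>.G.generate_subgroup_incl[OF _ realize.subgroup_kernel])
      (auto simp: kernel_def realize_commutator ker)
  with v have v1: "realize v = \<one>\<^bsub>M\<^esub>" by (auto simp: kernel_def)
  have v2: "exponent_sum a v = 0" for a :: nat
  proof -
    interpret e: group_hom F integer_group "exponent_sum a"
      unfolding F_eq by (rule exponent_sum_hom)
    have "commutator_subgroup F (carrier F) R \<subseteq> kernel F integer_group (exponent_sum a)"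
      unfolding commutator_subgroup_def
      by (rule \<pi>.G.generate_subgroup_incl[OF _ e.subgroup_kernel])
        (use exponent_sum_commutator[of _ "{1..n}" _ a, folded F_eq] in \<open>auto simp: kernel_def\<close>)
    with v show ?thesis by (auto simp: kernel_def)
  qed
  obtain r where r: "r \<in> R" "realize u = realize r [^]\<^bsub>M\<^esub> q"
    "\<And>a. exponent_sum a u = int q * exponent_sum a r"
    using realize_power_subgroup[OF R ker u] by blast
  have "realize r [^]\<^bsub>M\<^esub> q = \<one>\<^bsub>M\<^esub>"
  proof (cases "q = 0")
    case False
    have "exponent_sum a r = 0" for a
    proof -
      have "0 = exponent_sum a (u \<otimes>\<^bsub>F\<^esub> v)"
        using exponent_sum_commutator[of x "{1..n}" y a, folded F_eq] x y uv by simp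
      also have "\<dots> = exponent_sum a u + exponent_sum a v"
        using group_hom.hom_mult[OF exponent_sum_hom[of "{1..n}" a, folded F_eq] c] by simp
      finally show ?thesis using r(3) v2 False by simp
    qed
    then have "r \<in> derived F (carrier F)"
      using r(1) exponent_sum_zero_imp_derived[of "{1..n}" r, folded F_eq] by simp
    moreover have "hatv \<one> = \<one>\<^bsub>T\<^esub>"
      using hat_relations False by (auto simp: hat_relations_def commutator_def dest!: bspec[of _ _ \<one>])
    ultimately show ?thesis
      using realize_power_derived[of r] ker[OF r(1)] False by simp
  qed simp
  then have "realize (commutator F x y) = \<one>\<^bsub>M\<^esub>"
    unfolding uv using c r v1 by simp
  then show ?thesis
    using x y by (intro shift_eq_one) (simp_all add: realize_commutator)
qed

end

section \<open>The \<open>q\<close>-exterior center\<close>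

text \<open>Conjugation by \<open>x\<close> permutes the defining relations, so the universal property turns it into an
  endomorphism of the exterior square.\<close>

lemma equivariant_exterior_pairing_exterior:
  assumes "group G"
  obtains act where
    "equivariant_exterior_pairing G (exterior_square q G) (exterior q G) q (exterior_hat q G) act"
proof -
  interpret e: q_exterior_pairing G "exterior_square q G" "exterior q G" q "exterior_hat q G"
    using assms by (rule q_exterior_pairing_exterior)
  have "\<exists>\<phi>. group_hom (exterior_square q G) (exterior_square q G) \<phi> \<and>
      (\<forall>g\<in>carrier G. \<forall>h\<in>carrier G.
        \<phi> (exterior q G g h) = exterior q G (conj_by G g x) (conj_by G h x))"
    if x: "x \<in> carrier G" for x
  proof -
    interpret c: group_hom G G "\<lambda>g. conj_by G g x" using x by (rule e.conj_by_hom)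
    interpret p: q_exterior_pairing G "exterior_square q G"
        "\<lambda>g h. exterior q G (conj_by G g x) (conj_by G h x)" q "\<lambda>k. exterior_hat q G (conj_by G k x)"
      by (rule c.q_exterior_pairing_pullback) (rule e.q_exterior_pairing_axioms)
    show ?thesis using p.exterior_square_universal by metis
  qed
  then obtain act where "\<And>x. x \<in> carrier G \<Longrightarrow>
      group_hom (exterior_square q G) (exterior_square q G) (act x) \<and>
      (\<forall>g\<in>carrier G. \<forall>h\<in>carrier G.
        act x (exterior q G g h) = exterior q G (conj_by G g x) (conj_by G h x))"
    by metis
  then show thesis by (intro that[of act]) (unfold_locales, auto simp: group_hom_def)
qed

theorem exterior_center_eq_image_center:
  fixes n :: nat
  assumes R: "R \<lhd> free_group {1..n}"
  shows "exterior_center q (free_group {1..n} Mod R) =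
    q_cover_epi (free_group {1..n}) R ` group_center (q_cover q (free_group {1..n}) R)"
proof -
  define F where "F = free_group {1..n}"
  interpret R: normal R F using R by (simp add: F_def)
  interpret E: q_central_extension "q_cover q F R" "F Mod R" "q_cover_epi F R" q
    by (rule R.q_central_extension_q_cover)
  interpret K: normal "q_cover_kernel q F R" F by (rule R.q_cover_kernel_normal)
  interpret k: group_hom F "q_cover q F R" "\<lambda>x. q_cover_kernel q F R #>\<^bsub>F\<^esub> x"
    unfolding q_cover_def by (rule K.coset_hom)
  interpret \<pi>: group_hom F "F Mod R" "\<lambda>x. R #>\<^bsub>F\<^esub> x" by (rule R.coset_hom)
  obtain act where "equivariant_exterior_pairing (F Mod R) (exterior_square q (F Mod R))
      (exterior q (F Mod R)) q (exterior_hat q (F Mod R)) act"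
    using equivariant_exterior_pairing_exterior[OF E.G.is_group] by blast
  then interpret p: free_exterior_pairing "F Mod R" "exterior_square q (F Mod R)"
      "exterior q (F Mod R)" q "exterior_hat q (F Mod R)" act n F "\<lambda>x. R #>\<^bsub>F\<^esub> x"
    by (intro free_exterior_pairing.intro free_exterior_pairing_axioms.intro \<pi>.group_hom_axioms F_def)
  have "q_cover_epi F R c \<in> exterior_center q (F Mod R)" if c: "c \<in> group_center (q_cover q F R)" for c
  proof -
    from c obtain x where x: "x \<in> carrier F" "c = q_cover_kernel q F R #>\<^bsub>F\<^esub> x"
      by (auto simp: group_center_def q_cover_def carrier_FactGroup)
    have "exterior q (F Mod R) (R #>\<^bsub>F\<^esub> x) (R #>\<^bsub>F\<^esub> y) = \<one>\<^bsub>exterior_square q (F Mod R)\<^esub>"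
      if y: "y \<in> carrier F" for y
    proof (rule p.w_trivial_if_central_in_q_cover[OF R.subgroup_axioms _ x(1) y])
      show "R #>\<^bsub>F\<^esub> r = \<one>\<^bsub>F Mod R\<^esub>" if "r \<in> R" for r
        using that R.coset_kernel by (auto simp: kernel_def)
      let ?y = "q_cover_kernel q F R #>\<^bsub>F\<^esub> y"
      have "c \<otimes>\<^bsub>q_cover q F R\<^esub> ?y = ?y \<otimes>\<^bsub>q_cover q F R\<^esub> c"
        using c y k.hom_closed[OF y] by (auto simp: group_center_def)
      moreover have "c \<in> carrier (q_cover q F R)" using c by (simp add: group_center_def)
      ultimately have "commutator (q_cover q F R) c ?y = \<one>\<^bsub>q_cover q F R\<^esub>"
        using k.hom_closed[OF y] by (simp add: commutator_def E.E.m_assoc)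
      then have "commutator F x y \<in> kernel F (q_cover q F R) (\<lambda>x. q_cover_kernel q F R #>\<^bsub>F\<^esub> x)"
        using x y by (simp add: kernel_def k.hom_commutator)
      then show "commutator F x y \<in> q_cover_kernel q F R"
        using K.coset_kernel by (simp add: q_cover_def)
    qed
    moreover have "q_cover_epi F R c = R #>\<^bsub>F\<^esub> x"
      unfolding x(2) using x(1) R.normal_axioms by (rule R.q_cover_epi_coset[rotated])
    ultimately show ?thesis
      using \<pi>.hom_closed[OF x(1)] by (auto simp: exterior_center_def carrier_FactGroup)
  qed
  moreover have "g \<in> q_cover_epi F R ` group_center (q_cover q F R)"
    if g: "g \<in> exterior_center q (F Mod R)" for g
  proof -
    have "g \<in> carrier (F Mod R)" using g by (simp add: exterior_center_def)
    then obtain c where "c \<in> carrier (q_cover q F R)" "g = q_cover_epi F R c"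
      using E.surj by blast
    with g show ?thesis using E.wedge_trivial_imp_center by blast
  qed
  ultimately show ?thesis unfolding F_def by blast
qed

theorem theorem5p1:
  fixes q n :: nat
    and I :: "nat set"
    and e :: "nat \<Rightarrow> nat"
    and \<alpha> :: "nat \<Rightarrow> nat \<Rightarrow> int"
    and \<beta> \<gamma> :: "nat \<Rightarrow> nat \<Rightarrow> nat \<Rightarrow> int"
  assumes "I \<subseteq> {1..n}"
    and "\<And>i. i \<in> I \<Longrightarrow> 0 < e i"
    and "pc_consistent n I e \<alpha> \<beta> \<gamma>"
  shows "exterior_center q (pc_group n I e \<alpha> \<beta> \<gamma>) =
         q_cover_epi (free_group {1..n}) (pc_kernel n I e \<alpha> \<beta> \<gamma>) `
           group_center (q_cover q (free_group {1..n}) (pc_kernel n I e \<alpha> \<beta> \<gamma>))"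
proof -
  define F where "F = free_group {1..n}"
  interpret F: group F unfolding F_def by (rule group_free_group)
  have gen: "free_gen i \<in> carrier F" if "1 \<le> i" "i \<le> n" for i
    using that by (simp add: F_def)
  have word: "pc_word F free_gen j n a \<in> carrier F" for j a
    unfolding pc_word_def by (intro F.list_mult_closed) (auto intro!: F.int_pow_closed gen)
  have "pc_relators n I e \<alpha> \<beta> \<gamma> \<subseteq> carrier F"
    unfolding pc_relators_def Let_def relator_def F_def[symmetric]
    using assms(1) by (auto intro!: F.m_closed F.inv_closed F.nat_pow_closed gen word)
  then have "pc_kernel n I e \<alpha> \<beta> \<gamma> \<lhd> free_group {1..n}"
    unfolding pc_kernel_def F_def[symmetric] by (rule F.normal_closure_normal)
  then show ?thesis
    unfolding pc_group_def by (rule exterior_center_eq_image_center)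
qed

end
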